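(* Let $r\ge 3$ and $t\ge 1$ be integers and let $\varepsilon>0$. If $D$ is a $T_r[t]$-free digraph on $n$ vertices with minimum out-degree $\delta^+(D)\ge\left(\frac{3r-7}{3r-4}+\varepsilon\right)n$ and $n$ is sufficiently large, then one can delete $o(n^2)$ arcs from $D$ to make it an $(r-1)$-partite digraph. That is: for every $\eta>0$ there exists $n_0=n_0(r,t,\varepsilon,\eta)$ such that every $T_r[t]$-free digraph $D$ on $n\ge n_0$ vertices with $\delta^+(D)\ge\left(\frac{3r-7}{3r-4}+\varepsilon\right)n$ can be made $(r-1)$-partite by deleting at most $\eta n^2$ arcs.
   Context: All digraphs are finite, may contain anti-parallel arcs (both $(u,v)$ and $(v,u)$), and have no loops or parallel arcs. $T_r$ is the transitive tournament with vertices $1,\dots,r$ and arcs $(i,j)$ for all $i<j$. The $t$-blow-up $T_r[t]$ is obtained by replacing each vertex $i$ by an independent set $I_i$ of size $t$ and adding all arcs from $I_i$ to $I_j$ whenever $i<j$. A digraph is $H$-free if it contains no (not necessarily induced) subdigraph isomorphic to $H$. $\delta^+(D)$ is the minimum out-degree. A digraph is $(r-1)$-partite if its vertex set can be partitioned into $r-1$ (possibly empty) sets, none of which contains both endpoints of an arc. *)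

theory Defs
  imports Complex_Main "Graph_Theory.Graph_Theory"
begin

text \<open>
  The digraphs of the statement are the \<^locale>\<open>pair_digraph\<close>s of the Graph Theory library:
  finite and loopfree, with arcs represented as ordered pairs, so that there are no parallel arcs
  while anti-parallel arcs are allowed.
\<close>

definition transitive_tournament :: "nat \<Rightarrow> nat pair_pre_digraph" where
  "transitive_tournament r = \<lparr> pverts = {1..r}, parcs = {(i, j). 1 \<le> i \<and> i < j \<and> j \<le> r} \<rparr>"

text \<open>In the blow-up, the vertex \<open>v\<close> is replaced by the independent set \<open>{v} \<times> {1..t}\<close>.\<close>

definition blow_up :: "'a pair_pre_digraph \<Rightarrow> nat \<Rightarrow> ('a \<times> nat) pair_pre_digraph" where
  "blow_up H t =
    \<lparr> pverts = pverts H \<times> {1..t},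
      parcs = {((u, i), (v, j)) | u v i j. (u, v) \<in> parcs H \<and> i \<in> {1..t} \<and> j \<in> {1..t}} \<rparr>"

definition digraph_free :: "('a, 'b) pre_digraph \<Rightarrow> ('c, 'd) pre_digraph \<Rightarrow> bool" where
  "digraph_free H G \<longleftrightarrow> \<not> (\<exists>S. subgraph S G \<and> digraph_iso H S)"

text \<open>The value is unspecified for a digraph without vertices.\<close>

definition min_out_degree :: "('a, 'b) pre_digraph \<Rightarrow> nat" where
  "min_out_degree G = Min (out_degree G ` verts G)"

definition partite :: "nat \<Rightarrow> ('a, 'b) pre_digraph \<Rightarrow> bool" where
  "partite k G \<longleftrightarrow>
    (\<exists>V :: nat \<Rightarrow> 'a set.
      (\<Union>i<k. V i) = verts G \<and> disjoint_family_on V {..<k} \<and>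
      (\<forall>i<k. \<forall>e \<in> arcs G. \<not> (tail G e \<in> V i \<and> head G e \<in> V i)))"

definition delete_arcs :: "'a pair_pre_digraph \<Rightarrow> ('a \<times> 'a) set \<Rightarrow> 'a pair_pre_digraph" where
  "delete_arcs G A = \<lparr> pverts = pverts G, parcs = parcs G - A \<rparr>"

end

theory Submission
  imports Defs
begin

text \<open>
  For a \<open>T\<^sub>r\<close>-free digraph whose minimum out-degree exceeds \<open>(3r-7)/(3r-4)\<close> times its order, the
  underlying graph contains no \<open>K\<^sub>r\<close>: a clique of the underlying graph can be converted, vertex by
  vertex, into a transitive tournament by appending common out-neighbours. By the
  Andrasfai--Erdos--Sos theorem, for which we follow Brandt's argument, such a digraph is
  \<open>(r-1)\<close>-partite. To pass to the stability statement without the regularity lemma, sample a tuple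
  of \<open>N\<close> vertices of \<open>D\<close>, with \<open>N\<close> a large constant, and consider the digraph induced on its indices.
  With high probability it has large minimum out-degree (Chernoff), and it is \<open>T\<^sub>r\<close>-free, as otherwise
  some \<open>r\<close> coordinates would span \<open>T\<^sub>r\<close> in a positive proportion of the tuples and then Erdos' theorem
  on complete multipartite hypergraphs would give \<open>T\<^sub>r[t]\<close> in \<open>D\<close>. So most samples are
  \<open>(r-1)\<close>-colourable, whereas most samples of a digraph that is far from \<open>(r-1)\<close>-partite are not, by
  the property-testing argument of Goldreich, Goldwasser and Ron.
\<close>

section \<open>The Andrasfai--Erdos--Sos theorem\<close>

definition clique :: "('a \<times> 'a) set \<Rightarrow> 'a set \<Rightarrow> bool" where
  "clique E K \<longleftrightarrow> (\<forall>u\<in>K. \<forall>v\<in>K. u \<noteq> v \<longrightarrow> (u, v) \<in> E)"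

definition proper_colouring :: "nat \<Rightarrow> ('a \<times> 'a) set \<Rightarrow> 'a set \<Rightarrow> ('a \<Rightarrow> nat) \<Rightarrow> bool" where
  "proper_colouring k E V f \<longleftrightarrow>
    f ` V \<subseteq> {..<k} \<and> (\<forall>u\<in>V. \<forall>v\<in>V. (u, v) \<in> E \<longrightarrow> f u \<noteq> f v)"

lemma clique_mono: "clique E K \<Longrightarrow> K' \<subseteq> K \<Longrightarrow> E \<subseteq> E' \<Longrightarrow> clique E' K'"
  by (auto simp: clique_def)

lemma clique_insertI:
  assumes "sym E" "clique E K" "\<And>u. u \<in> K \<Longrightarrow> (x, u) \<in> E"
  shows "clique E (insert x K)"
  using assms by (auto simp: clique_def dest: symD)

text \<open>Double counting of the pairs missing between \<open>S\<close> and \<open>V\<close>. The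
  degree arguments apply it to several, possibly overlapping, sets \<open>S\<close> at once, which
  gives their vertices different weights.\<close>

lemma sum_card_missing:
  fixes V :: "'a set" and \<delta> :: real
  assumes "finite V" "finite S"
    and "\<And>y. y \<in> S \<Longrightarrow> real (card {x\<in>V. (y, x) \<notin> E}) \<le> \<delta>"
  shows "(\<Sum>x\<in>V. real (card {y\<in>S. (y, x) \<notin> E})) \<le> \<delta> * card S"
proof -
  have "(\<Sum>x\<in>V. card {y\<in>S. (y, x) \<notin> E}) = (\<Sum>y\<in>S. card {x\<in>V. (y, x) \<notin> E})"
    using sum_multicount_gen[of V S "\<lambda>x y. (y, x) \<notin> E" "\<lambda>y. card {x\<in>V. (y, x) \<notin> E}"] assms by simp
  then have "(\<Sum>x\<in>V. real (card {y\<in>S. (y, x) \<notin> E})) = (\<Sum>y\<in>S. real (card {x\<in>V. (y, x) \<notin> E}))"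
    by (simp flip: of_nat_sum)
  also have "\<dots> \<le> (\<Sum>y\<in>S. \<delta>)" by (rule sum_mono) (use assms in auto)
  finally show ?thesis by (simp add: mult.commute)
qed

text \<open>The strict degree condition speaks of one vertex at a time; the maximum turns it into a
  single bound \<delta> that can be carried through a sum before strictness is used.\<close>

lemma max_missing:
  fixes V :: "'a set" and c d :: real
  assumes "finite V" "V \<noteq> {}" and "\<And>y. y \<in> V \<Longrightarrow> c * card {x\<in>V. (y, x) \<notin> E} < d"
  obtains \<delta> where "0 \<le> \<delta>" "c * \<delta> < d" "\<And>y. y \<in> V \<Longrightarrow> real (card {x\<in>V. (y, x) \<notin> E}) \<le> \<delta>"
proof -
  let ?M = "Max ((\<lambda>y. card {x\<in>V. (y, x) \<notin> E}) ` V)"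
  have "?M \<in> (\<lambda>y. card {x\<in>V. (y, x) \<notin> E}) ` V" using assms by (intro Max_in) auto
  then have "c * ?M < d" using assms(3) by force
  moreover have "real (card {x\<in>V. (y, x) \<notin> E}) \<le> ?M" if "y \<in> V" for y using that assms(1) by simp
  ultimately show thesis using that[of ?M] by simp
qed

text \<open>
  A wheel consists of a rim edge \<open>(a, b)\<close>, a vertex \<open>v\<close> adjacent to neither \<open>a\<close> nor \<open>b\<close>, and
  cliques \<open>s\<close>, \<open>t\<close> of size \<open>m\<close> joining \<open>v\<close> to \<open>a\<close> and \<open>v\<close> to \<open>b\<close>, respectively. When
  \<open>card (s \<inter> t) = m - 1\<close> this is a 5-cycle joined to a clique of size \<open>m - 1\<close>.
\<close>

definition wheel :: "('a \<times> 'a) set \<Rightarrow> 'a set \<Rightarrow> nat \<Rightarrow> 'a \<Rightarrow> 'a \<Rightarrow> 'a \<Rightarrow> 'a set \<Rightarrow> 'a set \<Rightarrow> bool" where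
  "wheel E V m v a b s t \<longleftrightarrow>
    v \<in> V \<and> a \<in> V \<and> b \<in> V \<and> s \<subseteq> V \<and> t \<subseteq> V \<and> card s = m \<and> card t = m \<and>
    (a, b) \<in> E \<and> (v, a) \<notin> E \<and> (v, b) \<notin> E \<and>
    v \<notin> s \<and> v \<notin> t \<and> a \<notin> s \<and> b \<notin> t \<and>
    clique E (insert v s) \<and> clique E (insert a s) \<and> clique E (insert v t) \<and> clique E (insert b t)"

text \<open>
  A vertex missing less than weight 3 could be put into both \<open>s\<close> and \<open>t\<close> in exchange for
  the vertex it misses there, which enlarges \<open>s \<inter> t\<close>. Vertices of \<open>s \<inter> t\<close> carry weight 3, as
  they are counted in \<open>s\<close>, in \<open>t\<close>, and in \<open>s \<inter> t\<close>.
\<close>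

lemma wheel_missing:
  assumes "finite V" "sym E" "irrefl E"
    and free: "\<And>K. K \<subseteq> V \<Longrightarrow> clique E K \<Longrightarrow> card K \<noteq> m + 2"
    and W: "wheel E V m v a b s t"
    and max: "\<And>s' t'. wheel E V m v a b s' t' \<Longrightarrow> card (s' \<inter> t') \<le> card (s \<inter> t)"
    and x: "x \<in> V"
  shows "3 \<le> card {y\<in>{v, a, b}. (y, x) \<notin> E} + card {y\<in>s. (y, x) \<notin> E}
    + card {y\<in>t. (y, x) \<notin> E} + card {y\<in>s \<inter> t. (y, x) \<notin> E}"
proof -
  note w = W[unfolded wheel_def]
  have irr: "(u, u) \<notin> E" for u using assms(3) by (auto simp: irrefl_def)
  have symE: "(u, w) \<in> E \<longleftrightarrow> (w, u) \<in> E" for u w using assms(2) by (auto dest: symD)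
  have fin: "finite s" "finite t" using w assms(1) by (auto intro: finite_subset)
  have vab: "v \<noteq> a" "v \<noteq> b" "a \<noteq> b" using w irr symE by auto
  let ?H = "{y\<in>{v, a, b}. (y, x) \<notin> E}"
  let ?S = "{y\<in>s. (y, x) \<notin> E}" and ?T = "{y\<in>t. (y, x) \<notin> E}" and ?I = "{y\<in>s \<inter> t. (y, x) \<notin> E}"
  have ext: "\<exists>y\<in>insert u K. (y, x) \<notin> E"
    if "u \<notin> K" "card K = m" "insert u K \<subseteq> V" "clique E (insert u K)" for u K
  proof (rule ccontr)
    assume "\<not> ?thesis"
    then have adj: "\<And>y. y \<in> insert u K \<Longrightarrow> (x, y) \<in> E" using symE by blast
    then have "x \<notin> insert u K" using irr by blast
    moreover have "finite K" using that(3) assms(1) by (auto intro: finite_subset)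
    ultimately have "card (insert x (insert u K)) = m + 2" using that by simp
    moreover have "clique E (insert x (insert u K))"
      using clique_insertI[OF assms(2) that(4)] adj by blast
    ultimately show False using free[of "insert x (insert u K)"] that x by blast
  qed
  have SV: "?S = {} \<Longrightarrow> (v, x) \<notin> E \<and> (a, x) \<notin> E" using ext[of v s] ext[of a s] w by blast
  have TV: "?T = {} \<Longrightarrow> (v, x) \<notin> E \<and> (b, x) \<notin> E" using ext[of v t] ext[of b t] w by blast
  have pos: "X \<noteq> {} \<Longrightarrow> finite X \<Longrightarrow> 1 \<le> card X" for X :: "'a set"
    by (simp add: Suc_le_eq card_gt_0_iff)
  \<comment> \<open>A vertex missed in \<open>s \<inter> t\<close> counts three times. If nothing is
    missed in \<open>s\<close>, then both \<open>v\<close> and \<open>a\<close> are, and likewise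
    \<open>v\<close> and \<open>b\<close> for \<open>t\<close>. The exchange is left for the case
    that something is missed in both, but nothing in common.\<close>
  show ?thesis
  proof (cases "?I = {}")
    case False
    then have "1 \<le> card ?S" "1 \<le> card ?T" "1 \<le> card ?I" using fin by (intro pos; auto)+
    then show ?thesis by linarith
  next
    case I: True
    show ?thesis
    proof (cases "?S = {} \<or> ?T = {}")
      case True
      consider "?S = {}" "?T = {}" | "?S = {}" "?T \<noteq> {}" | "?S \<noteq> {}" "?T = {}" using True by blast
      then show ?thesis
      proof cases
        case 1
        then have "?H = {v, a, b}" using SV TV by auto
        then have "card ?H = 3" using vab by simp
        then show ?thesis by linarith
      next
        case 2
        then have "{v, a} \<subseteq> ?H" using SV by auto
        then have "card {v, a} \<le> card ?H" by (intro card_mono) auto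
        moreover have "1 \<le> card ?T" using 2 fin by (intro pos) auto
        ultimately show ?thesis using vab by simp
      next
        case 3
        then have "{v, b} \<subseteq> ?H" using TV by auto
        then have "card {v, b} \<le> card ?H" by (intro card_mono) auto
        moreover have "1 \<le> card ?S" using 3 fin by (intro pos) auto
        ultimately show ?thesis using vab by simp
      qed
    next
      case ne: False
      then have ge1: "1 \<le> card ?S" "1 \<le> card ?T" using fin by (intro pos; auto)+
      show ?thesis
      proof (rule ccontr)
        assume "\<not> ?thesis"
        with ge1 have "card ?H = 0" and c1: "card ?S = 1" "card ?T = 1" by linarith+
        then have "?H = {}" by (subst (asm) card_0_eq) auto
        then have adj: "(x, v) \<in> E" "(x, a) \<in> E" "(x, b) \<in> E" using symE by blast+
        from c1 obtain y z where yz: "?S = {y}" "?T = {z}" by (meson card_1_singletonE)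
        define s' t' where "s' = insert x (s - {y})" and "t' = insert x (t - {z})"
        have y: "y \<in> s" "y \<notin> t" and z: "z \<in> t" "z \<notin> s" using yz I by blast+
        have xs: "x \<notin> s - {y}" "x \<notin> t - {z}" "x \<notin> s \<inter> t" using yz I irr by blast+
        have xadj: "\<And>u. u \<in> s - {y} \<Longrightarrow> (x, u) \<in> E" "\<And>u. u \<in> t - {z} \<Longrightarrow> (x, u) \<in> E"
          using yz symE by blast+
        have cl: "clique E (insert u s')" if "clique E (insert u s)" "(x, u) \<in> E" for u
        proof -
          have "clique E (insert x (insert u (s - {y})))"
            using that xadj by (intro clique_insertI[OF assms(2)] clique_mono[OF that(1)]) auto
          then show ?thesis by (simp add: s'_def insert_commute)
        qed
        have cl2: "clique E (insert u t')" if "clique E (insert u t)" "(x, u) \<in> E" for u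
        proof -
          have "clique E (insert x (insert u (t - {z})))"
            using that xadj by (intro clique_insertI[OF assms(2)] clique_mono[OF that(1)]) auto
          then show ?thesis by (simp add: t'_def insert_commute)
        qed
        have cards: "card s' = m" "card t' = m"
          using xs y z w fin card_Suc_Diff1[of s y] card_Suc_Diff1[of t z] by (auto simp: s'_def t'_def)
        have mem: "v \<notin> s'" "v \<notin> t'" "a \<notin> s'" "b \<notin> t'" "s' \<subseteq> V" "t' \<subseteq> V"
          using w adj irr x by (auto simp: s'_def t'_def)
        have "wheel E V m v a b s' t'"
          unfolding wheel_def using w by (intro conjI mem cards cl cl2 adj) blast+
        then have "card (s' \<inter> t') \<le> card (s \<inter> t)" by (rule max)
        moreover have "card (insert x (s \<inter> t)) \<le> card (s' \<inter> t')"
          using y z fin by (intro card_mono) (auto simp: s'_def t'_def)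
        ultimately show False using xs fin by simp
      qed
    qed
  qed
qed

text \<open>Among the wheels on \<open>v\<close>, \<open>a\<close>, \<open>b\<close>, one with
  \<open>card (s \<inter> t)\<close> maximal is taken. Since \<open>s = t\<close> would form a
  clique of size \<open>m + 2\<close> with \<open>a\<close> and \<open>b\<close>, its total weight
  is at most 3 + m + m + (m - 1) = 3m + 2. Every vertex misses weight at least 3, and averaging
  contradicts the degree condition.\<close>

lemma no_wheel:
  fixes V :: "'a set"
  assumes "finite V" "sym E" "irrefl E"
    and free: "\<And>K. K \<subseteq> V \<Longrightarrow> clique E K \<Longrightarrow> card K \<noteq> m + 2"
    and deg: "\<And>y. y \<in> V \<Longrightarrow> (3 * real m + 2) * card {x\<in>V. (y, x) \<notin> E} < 3 * card V"
  shows "\<not> wheel E V m v a b s t"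
proof
  assume W0: "wheel E V m v a b s t"
  have "card (fst p \<inter> snd p) \<le> card V" if "case p of (s, t) \<Rightarrow> wheel E V m v a b s t" for p
    using that assms(1) by (intro card_mono) (auto simp: wheel_def)
  then obtain p where p: "case p of (s, t) \<Rightarrow> wheel E V m v a b s t"
    "\<forall>q. (case q of (s, t) \<Rightarrow> wheel E V m v a b s t) \<longrightarrow>
      card (fst q \<inter> snd q) \<le> card (fst p \<inter> snd p)"
    using ex_has_greatest_nat[of "\<lambda>(s, t). wheel E V m v a b s t" "(s, t)"
        "\<lambda>p. card (fst p \<inter> snd p)" "Suc (card V)"] W0 less_Suc_eq_le by blast
  define s t where "s = fst p" and "t = snd p"
  have W: "wheel E V m v a b s t" using p(1) by (simp add: s_def t_def case_prod_unfold)
  have max: "card (s' \<inter> t') \<le> card (s \<inter> t)" if "wheel E V m v a b s' t'" for s' t'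
    using p(2)[rule_format, of "(s', t')"] that by (simp add: s_def t_def)
  note w = W[unfolded wheel_def]
  have fin: "finite s" "finite t" using w assms(1) by (auto intro: finite_subset)
  have ab: "a \<noteq> b" using w assms(3) by (auto simp: irrefl_def)
  have "s \<noteq> t"
  proof
    assume st: "s = t"
    have cl: "clique E (insert a t)" "clique E (insert b t)" "a \<notin> t" "b \<notin> t" "(a, b) \<in> E"
      "insert a (insert b t) \<subseteq> V" "card t = m" using w st by blast+
    then have "(a, u) \<in> E" if "u \<in> insert b t" for u using that by (auto simp: clique_def)
    then have "clique E (insert a (insert b t))" by (intro clique_insertI[OF assms(2)] cl)
    moreover have "card (insert a (insert b t)) = m + 2" using cl ab fin by simp
    ultimately show False using free cl(6) by blast
  qed
  have sm: "card s = m" "card t = m" "s \<subseteq> V" "t \<subseteq> V" using w by blast+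
  have "s \<inter> t \<noteq> s" using fin sm \<open>s \<noteq> t\<close> card_subset_eq[of t s] by auto
  then have "card (s \<inter> t) < card s" by (intro psubset_card_mono fin) blast
  then have c: "card (s \<inter> t) + 1 \<le> m" using sm by simp
  obtain \<delta> where \<delta>: "0 \<le> \<delta>" "(3 * real m + 2) * \<delta> < 3 * card V"
    "\<And>y. y \<in> V \<Longrightarrow> real (card {x\<in>V. (y, x) \<notin> E}) \<le> \<delta>"
    using max_missing[OF assms(1) _ deg] w by blast
  have bound: "(\<Sum>x\<in>V. real (card {y\<in>S. (y, x) \<notin> E})) \<le> \<delta> * card S" if "S \<subseteq> V" for S
    using that assms(1) \<delta>(3) by (intro sum_card_missing) (auto intro: finite_subset)
  have "3 * real (card V) = (\<Sum>x\<in>V. 3)" by simp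
  also have "\<dots> \<le> (\<Sum>x\<in>V. real (card {y\<in>{v, a, b}. (y, x) \<notin> E}) + real (card {y\<in>s. (y, x) \<notin> E})
    + real (card {y\<in>t. (y, x) \<notin> E}) + real (card {y\<in>s \<inter> t. (y, x) \<notin> E}))"
  proof (rule sum_mono)
    fix x assume "x \<in> V"
    then show "3 \<le> real (card {y\<in>{v, a, b}. (y, x) \<notin> E}) + real (card {y\<in>s. (y, x) \<notin> E})
      + real (card {y\<in>t. (y, x) \<notin> E}) + real (card {y\<in>s \<inter> t. (y, x) \<notin> E})"
      using wheel_missing[OF assms(1-3) free W max, of x] by linarith
  qed
  also have "\<dots> \<le> \<delta> * card {v, a, b} + \<delta> * card s + \<delta> * card t + \<delta> * card (s \<inter> t)"
    unfolding sum.distrib using w by (intro add_mono bound) auto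
  also have "\<dots> \<le> \<delta> * 3 + \<delta> * m + \<delta> * m + \<delta> * (real m - 1)"
    using c sm \<delta>(1) by (intro add_mono mult_left_mono) (auto simp: card_insert_if)
  also have "\<dots> = (3 * real m + 2) * \<delta>" by (simp add: algebra_simps)
  finally show False using \<delta>(2) by simp
qed

text \<open>In an edge-maximal supergraph without cliques of size \<open>m + 2\<close>,
  non-adjacency is transitive, because a failure would yield a wheel. Such a graph is complete
  multipartite, and its classes serve as colours. The set counted in \<open>deg\<close> contains
  \<open>y\<close> itself, so the condition means degree above (3m - 1)/(3m + 2) times the
  order.\<close>

theorem andrasfai_erdos_sos:
  fixes V :: "'a set"
  assumes "finite V" "E \<subseteq> V \<times> V" "sym E" "irrefl E"
    and free: "\<And>K. K \<subseteq> V \<Longrightarrow> clique E K \<Longrightarrow> card K \<noteq> m + 2"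
    and deg: "\<And>y. y \<in> V \<Longrightarrow> (3 * real m + 2) * card {x\<in>V. (y, x) \<notin> E} < 3 * card V"
  shows "\<exists>f. proper_colouring (m + 1) E V f"
proof -
  define \<F> where "\<F> = {F. F \<subseteq> V \<times> V \<and> sym F \<and> irrefl F \<and> (\<forall>K\<subseteq>V. clique F K \<longrightarrow> card K \<noteq> m + 2)}"
  have "finite (Pow (V \<times> V))" using assms(1) by simp
  then have "finite \<F>" by (rule finite_subset[rotated]) (auto simp: \<F>_def)
  moreover have "E \<in> \<F>" using assms by (auto simp: \<F>_def)
  ultimately obtain F where F: "F \<in> \<F>" "E \<subseteq> F" and max: "\<And>G. G \<in> \<F> \<Longrightarrow> F \<subseteq> G \<Longrightarrow> F = G"
    using finite_has_maximal2[of \<F> E] by metis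
  have Fp: "F \<subseteq> V \<times> V" "sym F" "irrefl F" "\<And>K. K \<subseteq> V \<Longrightarrow> clique F K \<Longrightarrow> card K \<noteq> m + 2"
    using F by (auto simp: \<F>_def)
  have deg': "(3 * real m + 2) * card {x\<in>V. (y, x) \<notin> F} < 3 * card V" if "y \<in> V" for y
  proof -
    have "card {x\<in>V. (y, x) \<notin> F} \<le> card {x\<in>V. (y, x) \<notin> E}"
      using F(2) assms(1) by (intro card_mono) auto
    then have "(3 * real m + 2) * card {x\<in>V. (y, x) \<notin> F} \<le> (3 * real m + 2) * card {x\<in>V. (y, x) \<notin> E}"
      by (intro mult_left_mono) auto
    then show ?thesis using deg[OF that] by linarith
  qed
  have nowheel: "\<not> wheel F V m v a b s t" for v a b s t
    using no_wheel[OF assms(1) Fp(2-4) deg'] by blast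
  have symF: "(u, w) \<in> F \<longleftrightarrow> (w, u) \<in> F" for u w using Fp(2) by (auto dest: symD)
  have ext: "\<exists>s\<subseteq>V. card s = m \<and> z \<notin> s \<and> x \<notin> s \<and> clique F (insert z s) \<and> clique F (insert x s)"
    if zx: "z \<in> V" "x \<in> V" "z \<noteq> x" "(z, x) \<notin> F" for z x
  proof -
    \<comment> \<open>By maximality the new edge lies in a clique of size \<open>m + 2\<close>; the
      rest of that clique is \<open>s\<close>.\<close>
    let ?G = "F \<union> {(z, x), (x, z)}"
    have "?G \<notin> \<F>" using max[of ?G] that(4) by blast
    moreover have "sym ?G" using Fp(2) by (auto simp: sym_def)
    moreover have "irrefl ?G" using Fp(3) that by (auto simp: irrefl_def)
    ultimately obtain K where K: "K \<subseteq> V" "clique ?G K" "card K = m + 2"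
      using Fp(1) zx by (auto simp: \<F>_def)
    have "z \<in> K" "x \<in> K"
      using Fp(4)[of K] K by (auto simp: clique_def)
    moreover have "finite K" using K(1) assms(1) by (auto intro: finite_subset)
    ultimately have "card (K - {z, x}) = m" using K(3) that(3) by (simp add: card_Diff_subset)
    moreover have "clique F (insert z (K - {z, x}))" "clique F (insert x (K - {z, x}))"
      using K(2) \<open>z \<in> K\<close> \<open>x \<in> K\<close> by (auto simp: clique_def)
    ultimately show ?thesis using K(1) by (intro exI[of _ "K - {z, x}"]) auto
  qed
  have multi: "(x, y) \<notin> F" if xyz: "x \<in> V" "y \<in> V" "z \<in> V" "(z, x) \<notin> F" "(z, y) \<notin> F" for x y z
  proof
    assume xy: "(x, y) \<in> F"
    then have "z \<noteq> x" "z \<noteq> y" using xyz symF by auto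
    then obtain s t where "s \<subseteq> V" "card s = m" "z \<notin> s" "x \<notin> s" "clique F (insert z s)" "clique F (insert x s)"
      "t \<subseteq> V" "card t = m" "z \<notin> t" "y \<notin> t" "clique F (insert z t)" "clique F (insert y t)"
      using ext xyz by meson
    then have "wheel F V m z x y s t" using that xy by (simp add: wheel_def)
    then show False using nowheel by blast
  qed
  \<comment> \<open>A maximal clique \<open>K\<close> represents every class: \<open>h\<close> sends
    a vertex to an element of \<open>K\<close> not adjacent to it, which for a member of
    \<open>K\<close> is the vertex itself.\<close>
  define \<K> where "\<K> = {K. K \<subseteq> V \<and> clique F K}"
  have "finite \<K>" using assms(1) by (simp add: \<K>_def)
  moreover have "{} \<in> \<K>" by (simp add: \<K>_def clique_def)
  ultimately obtain K where K: "K \<in> \<K>" and Kmax: "\<And>L. L \<in> \<K> \<Longrightarrow> K \<subseteq> L \<Longrightarrow> K = L"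
    using finite_has_maximal2[of \<K> "{}"] by metis
  have KV: "K \<subseteq> V" "clique F K" "finite K" using K assms(1) by (auto simp: \<K>_def intro: finite_subset)
  have "card K < m + 2"
  proof (rule ccontr)
    assume "\<not> ?thesis"
    then obtain L where "L \<subseteq> K" "card L = m + 2" by (meson not_less obtain_subset_with_card_n)
    then show False using Fp(4)[of L] KV clique_mono[of F K L F] by blast
  qed
  then have "card K \<le> card {..<m + 1}" by simp
  then obtain g where g: "inj_on g K" "g ` K \<subseteq> {..<m + 1}"
    using KV(3) card_le_inj[of K "{..<m + 1}"] by auto
  have "\<exists>u\<in>K. (u, v) \<notin> F" if "v \<in> V" for v
  proof (rule ccontr)
    assume asm: "\<not> ?thesis"
    then have "clique F (insert v K)" using symF by (intro clique_insertI Fp KV) blast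
    then have "K = insert v K" using that KV by (intro Kmax) (auto simp: \<K>_def)
    then show False using asm Fp(3) by (auto simp: irrefl_def)
  qed
  then obtain h where h: "\<And>v. v \<in> V \<Longrightarrow> h v \<in> K" "\<And>v. v \<in> V \<Longrightarrow> (h v, v) \<notin> F" by metis
  have "proper_colouring (m + 1) E V (g \<circ> h)"
    unfolding proper_colouring_def
  proof (intro conjI ballI impI)
    show "(g \<circ> h) ` V \<subseteq> {..<m + 1}" using g h by fastforce
    fix u v assume uv: "u \<in> V" "v \<in> V" "(u, v) \<in> E"
    show "(g \<circ> h) u \<noteq> (g \<circ> h) v"
    proof
      assume "(g \<circ> h) u = (g \<circ> h) v"
      then have "h u = h v" using g h uv by (auto dest: inj_onD)
      then have "(u, v) \<notin> F" using multi[of u v "h u"] h uv KV by (metis subsetD)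
      then show False using uv F by blast
    qed
  qed
  then show ?thesis by blast
qed

section \<open>Digraphs without transitive tournaments\<close>

text \<open>
  The semicomplete set \<open>P\<close> shrinks while the transitive tail \<open>qs\<close> dominated by it grows. The next
  vertex of the tail is a common out-neighbour of \<open>qs\<close> and of all but one vertex of \<open>P\<close>; it exists
  by double counting with weight 1 on \<open>P\<close> and weight 2 on \<open>qs\<close>. It may belong to \<open>P\<close> itself, in
  which case it is the vertex removed from \<open>P\<close>.
\<close>

lemma semicomplete_imp_transitive:
  fixes V :: "'a set"
  assumes "finite V"
    and deg: "\<And>y. y \<in> V \<Longrightarrow> (3 * real r - 4) * card {x\<in>V. (y, x) \<notin> E} < 3 * card V"
    and "2 \<le> p" "card P = p" "P \<subseteq> V" "clique (E \<union> E\<inverse>) P" "p + length qs = r"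
    and "set qs \<subseteq> V" "sorted_wrt (\<lambda>u v. (u, v) \<in> E) qs" "\<And>u q. u \<in> P \<Longrightarrow> q \<in> set qs \<Longrightarrow> (u, q) \<in> E"
  shows "\<exists>xs. length xs = r \<and> set xs \<subseteq> V \<and> sorted_wrt (\<lambda>u v. (u, v) \<in> E) xs"
  using assms(3-10)
proof (induction p arbitrary: P qs rule: nat_induct_at_least)
  case base
  then obtain c d where cd: "P = {c, d}" "c \<noteq> d" by (metis card_2_iff)
  then have "(c, d) \<in> E \<or> (d, c) \<in> E" using base.prems(3) by (auto simp: clique_def)
  then obtain a b where ab: "P = {a, b}" "(a, b) \<in> E" using cd by blast
  have "sorted_wrt (\<lambda>u v. (u, v) \<in> E) (a # b # qs)" using ab base.prems(6,7) by simp
  moreover have "length (a # b # qs) = r" using base by simp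
  moreover have "set (a # b # qs) \<subseteq> V" using ab base.prems(2,5) by auto
  ultimately show ?case by blast
next
  case (Suc p)
  have finP: "finite P" "P \<noteq> {}" using Suc.hyps Suc.prems by (auto intro: card_ge_0_finite)
  obtain \<delta> where \<delta>: "0 \<le> \<delta>" "(3 * real r - 4) * \<delta> < 3 * card V"
    "\<And>y. y \<in> V \<Longrightarrow> real (card {x\<in>V. (y, x) \<notin> E}) \<le> \<delta>"
    using max_missing[OF assms(1) _ deg] finP Suc.prems by blast
  have bound: "(\<Sum>x\<in>V. real (card {y\<in>S. (y, x) \<notin> E})) \<le> \<delta> * card S" if "S \<subseteq> V" for S
    using that assms(1) \<delta>(3) by (intro sum_card_missing) (auto intro: finite_subset)
  have ex_v: "\<exists>v\<in>V. card {y\<in>P. (y, v) \<notin> E} + 2 * card {y\<in>set qs. (y, v) \<notin> E} < 2"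
  proof (rule ccontr)
    assume "\<not> ?thesis"
    then have ge2: "2 \<le> card {y\<in>P. (y, v) \<notin> E} + 2 * card {y\<in>set qs. (y, v) \<notin> E}" if "v \<in> V" for v
      using that by force
    have "2 * real (card V) = (\<Sum>v\<in>V. 2)" by simp
    also have "\<dots> \<le> (\<Sum>v\<in>V. real (card {y\<in>P. (y, v) \<notin> E}) + 2 * real (card {y\<in>set qs. (y, v) \<notin> E}))"
    proof (rule sum_mono)
      fix v assume "v \<in> V"
      then show "2 \<le> real (card {y\<in>P. (y, v) \<notin> E}) + 2 * real (card {y\<in>set qs. (y, v) \<notin> E})"
        using ge2[of v] by linarith
    qed
    also have "\<dots> \<le> \<delta> * card P + 2 * (\<delta> * card (set qs))"
      unfolding sum.distrib sum_distrib_left[symmetric]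
      using Suc.prems by (intro add_mono mult_left_mono bound) auto
    also have "\<dots> \<le> \<delta> * card P + 2 * (\<delta> * length qs)"
      using \<delta>(1) card_length by (intro add_mono mult_left_mono) auto
    also have "\<dots> = \<delta> * (card P + 2 * length qs)" by (simp add: algebra_simps)
    \<comment> \<open>Here \<open>card P + 2 * length qs\<close> = 2r - p - 1 is at most 2r - 3, as
      p \<ge> 2, and thus below 2r - 8/3.\<close>
    also have "\<dots> \<le> \<delta> * (2 / 3 * (3 * real r - 4))"
      using \<delta>(1) Suc.hyps Suc.prems by (intro mult_left_mono) auto
    also have "\<dots> = 2 / 3 * ((3 * real r - 4) * \<delta>)" by simp
    finally show False using \<delta>(2) by linarith
  qed
  obtain v where v: "v \<in> V" "card {y\<in>P. (y, v) \<notin> E} \<le> 1" "card {y\<in>set qs. (y, v) \<notin> E} = 0"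
  proof -
    assume *: "\<And>v. v \<in> V \<Longrightarrow> card {y\<in>P. (y, v) \<notin> E} \<le> 1 \<Longrightarrow> card {y\<in>set qs. (y, v) \<notin> E} = 0 \<Longrightarrow> thesis"
    from ex_v obtain v where v: "v \<in> V" "card {y\<in>P. (y, v) \<notin> E} + 2 * card {y\<in>set qs. (y, v) \<notin> E} < 2" ..
    show thesis by (rule *[OF v(1)]) (use v(2) in linarith)+
  qed
  have qv: "(y, v) \<in> E" if "y \<in> set qs" for y using v(3) that by simp
  obtain u where u: "u \<in> P" "\<And>y. y \<in> P \<Longrightarrow> y \<noteq> u \<Longrightarrow> (y, v) \<in> E"
  proof (cases "{y\<in>P. (y, v) \<notin> E} = {}")
    case True
    then show ?thesis using that finP by blast
  next
    case False
    then have "0 < card {y\<in>P. (y, v) \<notin> E}" using finP(1) by (simp add: card_gt_0_iff)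
    then have "card {y\<in>P. (y, v) \<notin> E} = 1" using v(2) by linarith
    then obtain u where "{y\<in>P. (y, v) \<notin> E} = {u}" by (rule card_1_singletonE)
    then show ?thesis using that[of u] by blast
  qed
  have cardP: "card (P - {u}) = p" using Suc.prems(1) u(1) finP by simp
  show ?case
  proof (rule Suc.IH[of "P - {u}" "qs @ [v]"])
    show "card (P - {u}) = p" by (rule cardP)
    show "p + length (qs @ [v]) = r" using Suc.prems Suc.hyps cardP by simp
    show "clique (E \<union> E\<inverse>) (P - {u})" by (rule clique_mono[OF Suc.prems(3)]) auto
    show "sorted_wrt (\<lambda>u v. (u, v) \<in> E) (qs @ [v])" using Suc.prems qv by (simp add: sorted_wrt_append)
  qed (use Suc.prems u v in auto)
qed

text \<open>Passing to the symmetric closure only shrinks the missing sets, so a condition on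
  out-degrees suffices. A clique of size \<open>m + 2\<close> in the closure would give a transitive
  tournament, starting from the empty tail.\<close>

theorem transitive_free_colourable:
  fixes V :: "'a set"
  assumes "finite V" "E \<subseteq> V \<times> V" "irrefl E"
    and free: "\<And>xs. length xs = m + 2 \<Longrightarrow> set xs \<subseteq> V \<Longrightarrow> \<not> sorted_wrt (\<lambda>u v. (u, v) \<in> E) xs"
    and deg: "\<And>y. y \<in> V \<Longrightarrow> (3 * real m + 2) * card {x\<in>V. (y, x) \<notin> E} < 3 * card V"
  shows "\<exists>f. proper_colouring (m + 1) E V f"
proof -
  have "\<exists>f. proper_colouring (m + 1) (E \<union> E\<inverse>) V f"
  proof (rule andrasfai_erdos_sos[OF assms(1)])
    show "E \<union> E\<inverse> \<subseteq> V \<times> V" "sym (E \<union> E\<inverse>)" "irrefl (E \<union> E\<inverse>)"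
      using assms by (auto simp: sym_def irrefl_def)
    show "card K \<noteq> m + 2" if "K \<subseteq> V" "clique (E \<union> E\<inverse>) K" for K
    proof
      assume "card K = m + 2"
      then have "\<exists>xs. length xs = m + 2 \<and> set xs \<subseteq> V \<and> sorted_wrt (\<lambda>u v. (u, v) \<in> E) xs"
        using that deg by (intro semicomplete_imp_transitive[where p = "m + 2" and P = K and qs = "[]", OF assms(1)])
          (auto simp: algebra_simps)
      then show False using free by blast
    qed
    show "(3 * real m + 2) * card {x\<in>V. (y, x) \<notin> E \<union> E\<inverse>} < 3 * card V" if "y \<in> V" for y
    proof -
      have "card {x\<in>V. (y, x) \<notin> E \<union> E\<inverse>} \<le> card {x\<in>V. (y, x) \<notin> E}"
        using assms(1) by (intro card_mono) auto
      then have "(3 * real m + 2) * card {x\<in>V. (y, x) \<notin> E \<union> E\<inverse>} \<le> (3 * real m + 2) * card {x\<in>V. (y, x) \<notin> E}"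
        by (intro mult_left_mono) auto
      then show ?thesis using deg[OF that] by linarith
    qed
  qed
  then show ?thesis by (auto simp: proper_colouring_def)
qed

section \<open>Testing colourability on tuples of vertices\<close>

abbreviation tuples :: "'a set \<Rightarrow> nat \<Rightarrow> 'a list set" where
  "tuples V q \<equiv> {xs. set xs \<subseteq> V \<and> length xs = q}"

lemma sum_tuples_Suc:
  assumes "finite V"
  shows "(\<Sum>zs\<in>tuples V (Suc q). g zs) = (\<Sum>x\<in>V. \<Sum>xs\<in>tuples V q. g (x # xs))"
proof -
  have "(\<Sum>x\<in>V. \<Sum>xs\<in>tuples V q. g (x # xs)) = (\<Sum>(x, xs)\<in>V \<times> tuples V q. g (x # xs))"
    using assms by (intro sum.cartesian_product)
  also have "\<dots> = (\<Sum>zs\<in>tuples V (Suc q). g zs)"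
    by (rule sum.reindex_bij_witness[of _ "\<lambda>zs. (hd zs, tl zs)" "\<lambda>(x, xs). x # xs"])
      (auto simp: length_Suc_conv)
  finally show ?thesis ..
qed

lemma card_tuples_Suc:
  assumes "finite V"
  shows "card {zs\<in>tuples V (Suc q). Q zs} = (\<Sum>x\<in>V. card {xs\<in>tuples V q. Q (x # xs)})"
  using sum_tuples_Suc[OF assms, of "\<lambda>zs. of_bool (Q zs) :: nat" q] assms
  by (simp add: sum_of_bool_eq finite_lists_length_eq Int_def)

lemma finite_tuples: "finite V \<Longrightarrow> finite {xs\<in>tuples V q. Q xs}"
  by (rule finite_subset[OF _ finite_lists_length_eq[of V q]]) auto

lemma card_tuples_le:
  assumes "finite V"
  shows "real (card {xs\<in>tuples V q. Q xs}) \<le> real (card V) ^ q"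
  unfolding of_nat_power[symmetric] of_nat_le_iff card_lists_length_eq[OF assms, symmetric]
  by (rule card_mono[OF finite_lists_length_eq[OF assms]]) blast

lemma exists_large_member:
  fixes c :: real
  assumes "finite I" "I \<noteq> {}" "A \<subseteq> (\<Union>i\<in>I. F i)" "c \<le> card A" "\<And>i. i \<in> I \<Longrightarrow> finite (F i)"
  shows "\<exists>i\<in>I. c / card I \<le> card (F i)"
proof (rule ccontr)
  assume "\<not> ?thesis"
  then have "(\<Sum>i\<in>I. real (card (F i))) < (\<Sum>i\<in>I. c / card I)"
    using assms by (intro sum_strict_mono) force+
  also have "\<dots> = c" using assms by simp
  also have "c \<le> real (card (\<Union>i\<in>I. F i))" using assms by (meson card_mono finite_UN_I of_nat_mono order_trans)
  also have "\<dots> \<le> (\<Sum>i\<in>I. real (card (F i)))"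
    unfolding of_nat_sum[symmetric] of_nat_le_iff by (rule card_UN_le[OF assms(1)])
  finally show False by simp
qed

text \<open>The list \<open>L v\<close> holds the colours still available at \<open>v\<close> once
  earlier entries of a tuple have been coloured, which permits recursion along the tuple. Repeated
  entries share one colour.\<close>

definition list_colourable :: "('a \<times> 'a) set \<Rightarrow> ('a \<Rightarrow> nat set) \<Rightarrow> 'a list \<Rightarrow> bool" where
  "list_colourable E L xs \<longleftrightarrow>
    (\<exists>f. (\<forall>v\<in>set xs. f v \<in> L v) \<and> (\<forall>u\<in>set xs. \<forall>v\<in>set xs. (u, v) \<in> E \<longrightarrow> f u \<noteq> f v))"

text \<open>Deleting the monochromatic arcs of \<open>f\<close> makes the digraph
  \<open>k\<close>-partite, so the negation supplies the arcs to delete.\<close>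

definition far_from_colourable :: "nat \<Rightarrow> real \<Rightarrow> 'a set \<Rightarrow> ('a \<times> 'a) set \<Rightarrow> bool" where
  "far_from_colourable k \<eta> V E \<longleftrightarrow>
    (\<forall>f. f ` V \<subseteq> {..<k} \<longrightarrow> \<eta> * (real (card V))\<^sup>2 < card {(u, v)\<in>E. f u = f v})"

text \<open>These are the vertices whose lists shrink when \<open>v\<close> receives the colour
  \<open>c\<close>.\<close>

definition colour_conflicts :: "'a set \<Rightarrow> ('a \<times> 'a) set \<Rightarrow> ('a \<Rightarrow> nat set) \<Rightarrow> 'a \<Rightarrow> nat \<Rightarrow> 'a set" where
  "colour_conflicts V E L v c = {w\<in>V. (v, w) \<in> E \<union> E\<inverse> \<and> c \<in> L w}"

definition use_colour :: "('a \<times> 'a) set \<Rightarrow> ('a \<Rightarrow> nat set) \<Rightarrow> 'a \<Rightarrow> nat \<Rightarrow> 'a \<Rightarrow> nat set" where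
  "use_colour E L v c w = (if (v, w) \<in> E \<union> E\<inverse> then L w - {c} else L w)"

text \<open>A vertex with an empty list is heavy, too.\<close>

definition heavy :: "real \<Rightarrow> 'a set \<Rightarrow> ('a \<times> 'a) set \<Rightarrow> ('a \<Rightarrow> nat set) \<Rightarrow> 'a set" where
  "heavy \<beta> V E L = {v\<in>V. \<forall>c\<in>L v. \<beta> * card V \<le> card (colour_conflicts V E L v c)}"

lemma list_colourable_ConsD: "list_colourable E L (x # xs) \<Longrightarrow> list_colourable E L xs"
  by (fastforce simp: list_colourable_def)

lemma list_colourable_Cons_use_colour:
  assumes "list_colourable E L (x # xs)"
  shows "\<exists>c\<in>L x. list_colourable E (use_colour E L x c) xs"
proof -
  obtain f where f: "\<And>v. v \<in> set (x # xs) \<Longrightarrow> f v \<in> L v"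
    "\<And>u v. u \<in> set (x # xs) \<Longrightarrow> v \<in> set (x # xs) \<Longrightarrow> (u, v) \<in> E \<Longrightarrow> f u \<noteq> f v"
    using assms unfolding list_colourable_def by blast
  have "f v \<in> use_colour E L x (f x) v" if "v \<in> set xs" for v
    using f(1)[of v] f(2)[of x v] f(2)[of v x] that by (auto simp: use_colour_def)
  then have "list_colourable E (use_colour E L x (f x)) xs"
    unfolding list_colourable_def using f(2) by (intro exI[of _ f]) auto
  then show ?thesis using f(1) by auto
qed

text \<open>Otherwise each vertex that is not heavy gets a colour with few conflicts, and the heavy
  ones get 0. A monochromatic arc starts at a heavy vertex, ends at one, or is a conflict of its
  tail. Each kind accounts for at most a third of \<eta> times the square of
  \<open>card V\<close>.\<close>

lemma many_heavy:
  fixes V :: "'a set"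
  assumes "finite V" "E \<subseteq> V \<times> V" "far_from_colourable k \<eta> V E" "0 < k" "0 < \<eta>" "\<And>v. L v \<subseteq> {..<k}"
  shows "\<eta> / 3 * card V \<le> card (heavy (\<eta> / 3) V E L)"
proof (rule ccontr)
  let ?\<beta> = "\<eta> / 3" and ?n = "real (card V)"
  let ?H = "heavy ?\<beta> V E L"
  assume "\<not> ?thesis"
  then have small: "card ?H \<le> ?\<beta> * ?n" by simp
  have "\<exists>c\<in>L v. card (colour_conflicts V E L v c) \<le> ?\<beta> * ?n" if "v \<in> V - ?H" for v
    using that by (force simp: heavy_def)
  then obtain g where g: "\<And>v. v \<in> V - ?H \<Longrightarrow> g v \<in> L v"
    "\<And>v. v \<in> V - ?H \<Longrightarrow> card (colour_conflicts V E L v (g v)) \<le> ?\<beta> * ?n"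
    by metis
  define f where "f = (\<lambda>v. if v \<in> V - ?H then g v else 0)"
  have finH: "finite ?H" "?H \<subseteq> V" using assms(1) by (auto simp: heavy_def)
  have "f ` V \<subseteq> {..<k}" using g(1) assms(4,6) by (fastforce simp: f_def)
  then have "\<eta> * ?n\<^sup>2 < card {(u, v)\<in>E. f u = f v}"
    using assms(3) unfolding far_from_colourable_def by blast
  also have "\<dots> \<le> card (?H \<times> V \<union> V \<times> ?H \<union> (SIGMA v:V - ?H. colour_conflicts V E L v (g v)))"
  proof (intro of_nat_mono card_mono)
    show "finite (?H \<times> V \<union> V \<times> ?H \<union> (SIGMA v:V - ?H. colour_conflicts V E L v (g v)))"
      using assms(1) finH by (auto simp: colour_conflicts_def)
    show "{(u, v)\<in>E. f u = f v} \<subseteq> ?H \<times> V \<union> V \<times> ?H \<union> (SIGMA v:V - ?H. colour_conflicts V E L v (g v))"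
    proof (clarify, goal_cases)
      case (1 u v)
      then have "u \<in> V" "v \<in> V" using assms(2) by auto
      moreover have "v \<in> colour_conflicts V E L u (g u)" if "u \<notin> ?H" "v \<notin> ?H"
        using 1 that \<open>u \<in> V\<close> \<open>v \<in> V\<close> g(1)[of v] by (auto simp: colour_conflicts_def f_def)
      ultimately show ?case using 1 by blast
    qed
  qed
  also have "\<dots> \<le> card (?H \<times> V) + card (V \<times> ?H) + card (SIGMA v:V - ?H. colour_conflicts V E L v (g v))"
    by (meson add_le_mono1 card_Un_le of_nat_mono order_trans)
  also have "\<dots> = card ?H * ?n + ?n * card ?H + (\<Sum>v\<in>V - ?H. real (card (colour_conflicts V E L v (g v))))"
    using assms(1) by (simp add: card_cartesian_product card_SigmaI colour_conflicts_def)
  also have "\<dots> \<le> (?\<beta> * ?n) * ?n + ?n * (?\<beta> * ?n) + (\<Sum>v\<in>V - ?H. ?\<beta> * ?n)"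
    using small g(2) by (intro add_mono mult_right_mono mult_left_mono sum_mono) auto
  also have "(\<Sum>v\<in>V - ?H. ?\<beta> * ?n) \<le> ?n * (?\<beta> * ?n)"
    unfolding sum_constant using assms(1,5) card_mono[of V "V - ?H"] by (intro mult_right_mono) auto
  finally show False by (simp add: power2_eq_square)
qed

text \<open>The total list size is a potential. It falls by exactly the number of conflicts, as each
  conflicting vertex loses the single colour \<open>c\<close>.\<close>

lemma use_colour_potential:
  assumes "finite V" "\<And>w. finite (L w)" "v \<in> heavy \<beta> V E L" "c \<in> L v"
  shows "(\<Sum>w\<in>V. real (card (use_colour E L v c w))) + \<beta> * card V \<le> (\<Sum>w\<in>V. real (card (L w)))"
proof -
  have "(\<Sum>w\<in>V. real (card (use_colour E L v c w))) + card (colour_conflicts V E L v c)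
    = (\<Sum>w\<in>V. real (card (use_colour E L v c w)) + of_bool ((v, w) \<in> E \<union> E\<inverse> \<and> c \<in> L w))"
    using assms(1) by (simp add: sum.distrib sum_of_bool_eq colour_conflicts_def Int_def)
  also have "\<dots> = (\<Sum>w\<in>V. real (card (L w)))"
  proof (rule sum.cong)
    fix w
    show "real (card (use_colour E L v c w)) + of_bool ((v, w) \<in> E \<union> E\<inverse> \<and> c \<in> L w) = real (card (L w))"
      using card_Suc_Diff1[OF assms(2)[of w], of c] by (auto simp: use_colour_def simp del: card_Diff_insert)
  qed simp
  finally show ?thesis using assms(3,4) by (force simp: heavy_def)
qed

text \<open>
  A random vertex is heavy with probability at least \<open>\<eta> / 3\<close>, and whatever colour a heavy vertex
  receives, the total size of the colour lists drops by \<open>\<eta> / 3 * card V\<close>. This can happen only a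
  bounded number \<open>j\<close> of times.
\<close>

lemma few_list_colourable:
  fixes \<eta> \<delta> :: real
  assumes "0 < k" "0 < \<eta>" "0 < \<delta>"
  shows "\<exists>q0. \<forall>q\<ge>q0. \<forall>(V :: 'a set) E L. finite V \<longrightarrow> E \<subseteq> V \<times> V \<longrightarrow> far_from_colourable k \<eta> V E \<longrightarrow>
    (\<forall>v. L v \<subseteq> {..<k}) \<longrightarrow> (\<Sum>v\<in>V. real (card (L v))) < real j * (\<eta> / 3 * card V) \<longrightarrow>
    card {xs\<in>tuples V q. list_colourable E L xs} \<le> \<delta> * real (card V) ^ q"
  using assms(3)
proof (induction j arbitrary: \<delta>)
  case 0
  have "\<not> (\<Sum>v\<in>V. real (card (L v))) < 0" for V and L :: "'a \<Rightarrow> nat set"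
    by (simp add: sum_nonneg not_less)
  then show ?case by simp
next
  case (Suc j)
  let ?\<beta> = "\<eta> / 3"
  \<comment> \<open>The divisor \<open>k\<close> pays for the union over the colours of a heavy
    vertex; the other half of \<delta> is kept for tuples that meet no heavy vertex early.\<close>
  have "0 < \<delta> / 2 / k" using Suc.prems assms(1) by simp
  from Suc.IH[OF this] obtain q0 where "\<forall>q\<ge>q0. \<forall>(V :: 'a set) E L. finite V \<longrightarrow> E \<subseteq> V \<times> V \<longrightarrow>
    far_from_colourable k \<eta> V E \<longrightarrow> (\<forall>v. L v \<subseteq> {..<k}) \<longrightarrow>
    (\<Sum>v\<in>V. real (card (L v))) < real j * (?\<beta> * card V) \<longrightarrow>
    card {xs\<in>tuples V q. list_colourable E L xs} \<le> \<delta> / 2 / k * real (card V) ^ q" ..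
  note q0 = this[rule_format]
  obtain m where m: "(1 - ?\<beta>) ^ m < \<delta> / 2"
    using real_arch_pow_inv[of "\<delta> / 2" "1 - ?\<beta>"] Suc.prems assms by auto
  show ?case
  proof (rule exI[of _ "q0 + m"], intro allI impI)
    fix q and V :: "'a set" and E L
    assume q: "q0 + m \<le> q" and V: "finite V" "E \<subseteq> V \<times> V" and far: "far_from_colourable k \<eta> V E"
      and "\<forall>v. L v \<subseteq> {..<k}" and pot: "(\<Sum>v\<in>V. real (card (L v))) < real (Suc j) * (?\<beta> * card V)"
    then have L: "\<And>v. L v \<subseteq> {..<k}" "\<And>v. finite (L v)" by (auto intro: finite_subset[OF _ finite_lessThan])
    let ?n = "real (card V)"
    let ?H = "heavy ?\<beta> V E L"
    let ?C = "\<lambda>L q. card {xs\<in>tuples V q. list_colourable E L xs}"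
    have HV: "?H \<subseteq> V" "finite ?H" using V(1) by (auto simp: heavy_def)
    have H: "?\<beta> * ?n \<le> card ?H" using V far L assms by (intro many_heavy)
    have nonheavy: "card {xs\<in>tuples V q. list_colourable E L (x # xs)} \<le> ?C L q" for x q
      using V(1) by (intro card_mono finite_tuples) (auto dest: list_colourable_ConsD)
    have heavy: "card {xs\<in>tuples V q. list_colourable E L (x # xs)} \<le> \<delta> / 2 * ?n ^ q"
      if "x \<in> ?H" "q0 \<le> q" for x q
    proof -
      have "card {xs\<in>tuples V q. list_colourable E L (x # xs)}
        \<le> card (\<Union>c\<in>L x. {xs\<in>tuples V q. list_colourable E (use_colour E L x c) xs})"
        using V(1) L by (intro card_mono finite_UN_I finite_tuples) (auto dest: list_colourable_Cons_use_colour)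
      also have "\<dots> \<le> (\<Sum>c\<in>L x. ?C (use_colour E L x c) q)" by (rule card_UN_le) (rule L)
      finally have "real (card {xs\<in>tuples V q. list_colourable E L (x # xs)}) \<le> (\<Sum>c\<in>L x. real (?C (use_colour E L x c) q))"
        by (simp flip: of_nat_sum)
      also have "\<dots> \<le> (\<Sum>c\<in>L x. \<delta> / 2 / k * ?n ^ q)"
      proof (intro sum_mono q0 that V far)
        fix c assume c: "c \<in> L x"
        show "use_colour E L x c v \<subseteq> {..<k}" for v using L(1)[of v] by (auto simp: use_colour_def)
        show "(\<Sum>v\<in>V. real (card (use_colour E L x c v))) < real j * (?\<beta> * ?n)"
          using use_colour_potential[OF V(1) L(2) that(1) c] pot by (simp add: algebra_simps)
      qed
      also have "\<dots> = card (L x) * (\<delta> / 2 / k * ?n ^ q)" by simp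
      also have "\<dots> \<le> k * (\<delta> / 2 / k * ?n ^ q)"
        using Suc.prems card_mono[OF _ L(1)[of x]] by (intro mult_right_mono) auto
      finally show ?thesis using assms(1) by simp
    qed
    \<comment> \<open>The power accounts for tuples without a heavy vertex among the first
      \<open>i\<close> entries; entries that are not heavy are discarded with the lists unchanged.
      At the first heavy entry at least \<open>q0\<close> entries remain, so the induction
      hypothesis on \<open>j\<close> applies to them.\<close>
    have bound: "?C L (q0' + i) \<le> ((1 - ?\<beta>) ^ i + \<delta> / 2) * ?n ^ (q0' + i)" if "q0 \<le> q0'" for q0' i
    proof (induction i)
      case 0
      have "real (?C L q0') \<le> ?n ^ q0'" by (rule card_tuples_le[OF V(1)])
      also have "\<dots> \<le> (1 + \<delta> / 2) * ?n ^ q0'" using Suc.prems by (simp add: mult_left_mono algebra_simps)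
      finally show ?case by simp
    next
      case (Suc i)
      let ?q = "q0' + i"
      \<comment> \<open>For non-empty \<open>V\<close> this forces \<open>?\<beta> \<le> 1\<close>,
        so the powers of \<open>1 - ?\<beta>\<close> are nonnegative even though \<eta> is an
        arbitrary positive real.\<close>
      have le1: "?\<beta> * ?n \<le> ?n" using H card_mono[OF V(1) HV(1)] by simp
      have "real (?C L (Suc ?q)) = (\<Sum>x\<in>V. real (card {xs\<in>tuples V ?q. list_colourable E L (x # xs)}))"
        unfolding card_tuples_Suc[OF V(1)] by simp
      also have "\<dots> = (\<Sum>x\<in>V - ?H. real (card {xs\<in>tuples V ?q. list_colourable E L (x # xs)}))
        + (\<Sum>x\<in>?H. real (card {xs\<in>tuples V ?q. list_colourable E L (x # xs)}))"
        by (rule sum.subset_diff[OF HV(1) V(1)])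
      also have "\<dots> \<le> (\<Sum>x\<in>V - ?H. ((1 - ?\<beta>) ^ i + \<delta> / 2) * ?n ^ ?q) + (\<Sum>x\<in>?H. \<delta> / 2 * ?n ^ ?q)"
        using that nonheavy[of ?q] Suc.IH heavy[of _ ?q]
        by (intro add_mono sum_mono) (force intro: order_trans[OF of_nat_mono])+
      also have "\<dots> = ((1 - ?\<beta>) ^ i * (?n - card ?H) + \<delta> / 2 * ?n) * ?n ^ ?q"
        using card_mono[OF V(1) HV(1)] HV
        by (simp add: card_Diff_subset of_nat_diff algebra_simps)
      also have "\<dots> \<le> ((1 - ?\<beta>) ^ i * (?n - ?\<beta> * ?n) + \<delta> / 2 * ?n) * ?n ^ ?q"
      proof (cases "?n = 0")
        case False
        then have "?\<beta> \<le> 1" using le1 by simp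
        then show ?thesis using H by (intro mult_right_mono add_mono mult_left_mono) auto
      next
        case True
        then show ?thesis using V(1) by (simp add: heavy_def)
      qed
      also have "\<dots> = ((1 - ?\<beta>) ^ Suc i + \<delta> / 2) * ?n ^ (Suc ?q)" by (simp add: algebra_simps)
      finally show ?case by simp
    qed
    have "q0 \<le> q - m" using q by simp
    from bound[OF this, of m] have "?C L q \<le> ((1 - ?\<beta>) ^ m + \<delta> / 2) * ?n ^ q" using q by simp
    also have "\<dots> \<le> \<delta> * ?n ^ q" using m by (intro mult_right_mono) auto
    finally show "?C L q \<le> \<delta> * ?n ^ q" .
  qed
qed

theorem few_colourable:
  fixes \<eta> \<delta> :: real
  assumes "0 < k" "0 < \<eta>" "0 < \<delta>"
  shows "\<exists>q0. \<forall>q\<ge>q0. \<forall>(V :: 'a set) E. finite V \<longrightarrow> E \<subseteq> V \<times> V \<longrightarrow> far_from_colourable k \<eta> V E \<longrightarrow>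
    card {xs\<in>tuples V q. list_colourable E (\<lambda>_. {..<k}) xs} \<le> \<delta> * real (card V) ^ q"
proof -
  \<comment> \<open>The initial lists have total size \<open>k * card V\<close>, which is less than
    \<open>j\<close> drops of \<open>\<eta> / 3 * card V\<close>.\<close>
  obtain j :: nat where j: "k / (\<eta> / 3) < j" using reals_Archimedean2 by blast
  have pot: "(\<Sum>v\<in>V. real (card {..<k})) < real j * (\<eta> / 3 * card V)"
    if "far_from_colourable k \<eta> V E" "finite V" "E \<subseteq> V \<times> V" for V :: "'a set" and E
  proof -
    \<comment> \<open>The strict inequality in \<open>far_from_colourable\<close> fails for the
      empty set.\<close>
    have "V \<noteq> {}" using that(1,3) by (auto simp: far_from_colourable_def)
    then have "k * real (card V) < (real j * (\<eta> / 3)) * card V"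
      using j assms that(2) by (intro mult_strict_right_mono) (auto simp: field_simps card_gt_0_iff)
    then show ?thesis by (simp add: algebra_simps)
  qed
  show ?thesis using few_list_colourable[OF assms, of j, where 'a='a] pot by (meson order_refl)
qed

section \<open>Degrees and complete multipartite patterns in tuples\<close>

lemma exp_minus_le_quadratic:
  fixes x :: real
  assumes "0 \<le> x"
  shows "exp (- x) \<le> 1 - x + x\<^sup>2 / 2"
proof -
  \<comment> \<open>The product equals 1 + x^4 / 4.\<close>
  have "1 \<le> (1 + x + x\<^sup>2 / 2) * (1 - x + x\<^sup>2 / 2)"
    using zero_le_power2[of "x\<^sup>2"] by (simp add: algebra_simps power2_eq_square)
  also have "\<dots> \<le> exp x * (1 - x + x\<^sup>2 / 2)"
  proof (rule mult_right_mono)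
    show "1 + x + x\<^sup>2 / 2 \<le> exp x" by (rule exp_lower_Taylor_quadratic[OF assms])
    have "0 \<le> (1 - x)\<^sup>2" by simp
    then show "0 \<le> 1 - x + x\<^sup>2 / 2" by (simp add: power2_diff)
  qed
  finally show ?thesis by (simp add: exp_minus field_simps)
qed

text \<open>The generating function factorises over the coordinates, each contributing
  \<open>b\<close> where \<open>Q\<close> holds and 1 elsewhere.\<close>

lemma sum_tuples_power_filter:
  fixes b :: real
  assumes "finite V"
  shows "(\<Sum>xs\<in>tuples V q. b ^ length (filter Q xs)) = (real (card V) - (1 - b) * card {v\<in>V. Q v}) ^ q"
proof (induction q)
  case 0
  have "tuples V 0 = {[]}" by auto
  then show ?case by simp
next
  case (Suc q)
  have "(\<Sum>x\<in>V. if Q x then b else 1) = (\<Sum>x\<in>V. 1 - (1 - b) * of_bool (Q x))"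
    by (rule sum.cong) auto
  also have "\<dots> = real (card V) - (1 - b) * card {v\<in>V. Q v}"
    using assms by (simp add: sum_subtractf sum_distrib_left[symmetric] sum_of_bool_eq Int_def)
  finally have factor: "(\<Sum>x\<in>V. if Q x then b else 1) = real (card V) - (1 - b) * card {v\<in>V. Q v}" .
  have "(\<Sum>xs\<in>tuples V (Suc q). b ^ length (filter Q xs))
    = (\<Sum>x\<in>V. \<Sum>xs\<in>tuples V q. (if Q x then b else 1) * b ^ length (filter Q xs))"
    unfolding sum_tuples_Suc[OF assms] by (intro sum.cong) auto
  also have "\<dots> = (\<Sum>x\<in>V. if Q x then b else 1) * (\<Sum>xs\<in>tuples V q. b ^ length (filter Q xs))"
    by (rule sum_product[symmetric])
  finally show ?case using Suc.IH factor by simp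
qed

text \<open>Markov's inequality for the weight \<open>b ^ length (filter Q xs)\<close> with
  \<open>b = exp (- \<epsilon>)\<close>. As 1 - b is at least \<epsilon> - \<epsilon>^2 / 2 and a +
  \<epsilon> \<le> 1, the exponent (1 - b)(a + \<epsilon>) is at least a \<epsilon> + \<epsilon>^2 /
  2; the term a \<epsilon> cancels against the threshold.\<close>

lemma chernoff_tuples:
  fixes a \<epsilon> :: real
  assumes "finite V" "V \<noteq> {}" "0 < \<epsilon>" "0 \<le> a" "(a + \<epsilon>) * card V \<le> card {v\<in>V. Q v}"
  shows "card {xs\<in>tuples V q. length (filter Q xs) \<le> a * q} \<le> (exp (- (\<epsilon>\<^sup>2 / 2)) * card V) ^ q"
proof -
  let ?n = "real (card V)"
  define b where "b = exp (- \<epsilon>)"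
  have b: "0 < b" "b < 1" using assms by (auto simp: b_def)
  have n: "0 < ?n" using assms(1,2) by (simp add: card_gt_0_iff)
  have "real (card {v\<in>V. Q v}) \<le> ?n" using assms(1) by (intro of_nat_mono card_mono) auto
  then have "(a + \<epsilon>) * ?n \<le> 1 * ?n" using assms(5) by simp
  then have ae: "a + \<epsilon> \<le> 1" using n by (simp only: mult_le_cancel_right_pos)
  let ?S = "{xs\<in>tuples V q. length (filter Q xs) \<le> a * q}"
  have "card ?S * exp (- \<epsilon> * (a * q)) = (\<Sum>xs\<in>?S. exp (- \<epsilon> * (a * q)))" by simp
  also have "\<dots> \<le> (\<Sum>xs\<in>?S. b ^ length (filter Q xs))"
    using assms(3) by (intro sum_mono) (auto simp: b_def exp_of_nat_mult[symmetric])
  also have "\<dots> \<le> (\<Sum>xs\<in>tuples V q. b ^ length (filter Q xs))"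
    using b assms(1) by (intro sum_mono2 finite_lists_length_eq) auto
  also have "\<dots> = (?n - (1 - b) * card {v\<in>V. Q v}) ^ q" by (rule sum_tuples_power_filter[OF assms(1)])
  also have "\<dots> \<le> (exp (- (1 - b) * (a + \<epsilon>)) * ?n) ^ q"
  proof (rule power_mono)
    have "(1 - b) * card {v\<in>V. Q v} \<le> 1 * ?n"
      using b assms(1) by (intro mult_mono of_nat_mono card_mono) auto
    then show "0 \<le> ?n - (1 - b) * card {v\<in>V. Q v}" by simp
    have "(1 - b) * ((a + \<epsilon>) * ?n) \<le> (1 - b) * card {v\<in>V. Q v}" using b assms(5) by (intro mult_left_mono) auto
    then have "?n - (1 - b) * card {v\<in>V. Q v} \<le> (1 + (- (1 - b) * (a + \<epsilon>))) * ?n" by (simp add: algebra_simps)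
    also have "\<dots> \<le> exp (- (1 - b) * (a + \<epsilon>)) * ?n" by (intro mult_right_mono exp_ge_add_one_self) simp
    finally show "?n - (1 - b) * card {v\<in>V. Q v} \<le> exp (- (1 - b) * (a + \<epsilon>)) * ?n" .
  qed
  also have "\<dots> \<le> (exp (- (\<epsilon>\<^sup>2 / 2)) * exp (- \<epsilon> * a) * ?n) ^ q"
  proof (intro power_mono mult_right_mono)
    have "(\<epsilon> - \<epsilon>\<^sup>2 / 2) * (a + \<epsilon>) \<le> (1 - b) * (a + \<epsilon>)"
      using exp_minus_le_quadratic[of \<epsilon>] assms by (intro mult_right_mono) (auto simp: b_def)
    moreover have "\<epsilon>\<^sup>2 / 2 * (a + \<epsilon>) \<le> \<epsilon>\<^sup>2 / 2 * 1" using ae by (intro mult_left_mono) auto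
    moreover have "(\<epsilon> - \<epsilon>\<^sup>2 / 2) * (a + \<epsilon>) = \<epsilon> * a + \<epsilon>\<^sup>2 - \<epsilon>\<^sup>2 / 2 * (a + \<epsilon>)"
      by (simp add: algebra_simps power2_eq_square)
    ultimately have "- (1 - b) * (a + \<epsilon>) \<le> - (\<epsilon>\<^sup>2 / 2) + - \<epsilon> * a"
      unfolding mult_minus_left by linarith
    then show "exp (- (1 - b) * (a + \<epsilon>)) \<le> exp (- (\<epsilon>\<^sup>2 / 2)) * exp (- \<epsilon> * a)"
      unfolding exp_add[symmetric] by simp
  qed auto
  also have "\<dots> = (exp (- (\<epsilon>\<^sup>2 / 2)) * ?n) ^ q * exp (- \<epsilon> * (a * q))"
    by (simp add: power_mult_distrib exp_of_nat_mult[symmetric] mult_ac)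
  finally show ?thesis by simp
qed

text \<open>Union bound over the position \<open>i\<close>. Removing the entry \<open>v\<close>
  there leaves a tuple of length \<open>q\<close> that is independent of \<open>v\<close> and
  contains no more out-neighbours of \<open>v\<close>, so the threshold is a multiple of
  \<open>q\<close>. The map \<open>?ins i\<close> puts the entry back.\<close>

lemma few_low_degree_tuples:
  fixes a \<epsilon> :: real
  assumes "finite V" "0 < \<epsilon>" "0 \<le> a" "\<And>v. v \<in> V \<Longrightarrow> (a + \<epsilon>) * card V \<le> card {w\<in>V. (v, w) \<in> E}"
  shows "card {xs\<in>tuples V (Suc q). \<exists>i<Suc q. length (filter (\<lambda>y. (xs ! i, y) \<in> E) xs) \<le> a * q}
    \<le> real (Suc q) * exp (- (\<epsilon>\<^sup>2 / 2)) ^ q * real (card V) ^ Suc q"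
proof -
  let ?S = "\<lambda>v. {ys\<in>tuples V q. length (filter (\<lambda>y. (v, y) \<in> E) ys) \<le> a * q}"
  let ?ins = "\<lambda>i (v, ys). take i ys @ v # drop i ys"
  have "{xs\<in>tuples V (Suc q). \<exists>i<Suc q. length (filter (\<lambda>y. (xs ! i, y) \<in> E) xs) \<le> a * q}
    \<subseteq> (\<Union>i<Suc q. ?ins i ` (SIGMA v:V. ?S v))"
  proof clarify
    fix xs i assume xs: "set xs \<subseteq> V" "length xs = Suc q" and i: "i < Suc q"
      and few: "real (length (filter (\<lambda>y. (xs ! i, y) \<in> E) xs)) \<le> a * q"
    define ys where "ys = take i xs @ drop (Suc i) xs"
    have split: "xs = take i xs @ xs ! i # drop (Suc i) xs" using xs i by (simp add: id_take_nth_drop)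
    have "length (filter (\<lambda>y. (xs ! i, y) \<in> E) ys) \<le> length (filter (\<lambda>y. (xs ! i, y) \<in> E) xs)"
    proof -
      have "length (filter Q ys) \<le> length (filter Q (take i xs @ xs ! i # drop (Suc i) xs))" for Q
        by (simp add: ys_def)
      then show ?thesis using split by metis
    qed
    moreover have "set ys \<subseteq> V" "length ys = q"
      using xs i by (auto simp: ys_def dest: in_set_takeD in_set_dropD)
    moreover have "xs ! i \<in> V" using xs i by auto
    ultimately have "(xs ! i, ys) \<in> (SIGMA v:V. ?S v)" using few by force
    moreover have "xs = ?ins i (xs ! i, ys)" using split xs i by (simp add: ys_def)
    ultimately show "xs \<in> (\<Union>i<Suc q. ?ins i ` (SIGMA v:V. ?S v))" using i by blast
  qed
  then have "card {xs\<in>tuples V (Suc q). \<exists>i<Suc q. length (filter (\<lambda>y. (xs ! i, y) \<in> E) xs) \<le> a * q}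
    \<le> card (\<Union>i<Suc q. ?ins i ` (SIGMA v:V. ?S v))"
    using assms(1) by (intro card_mono finite_UN_I finite_imageI finite_SigmaI finite_tuples) auto
  also have "\<dots> \<le> (\<Sum>i<Suc q. card (?ins i ` (SIGMA v:V. ?S v)))" by (rule card_UN_le) simp
  also have "\<dots> \<le> (\<Sum>i<Suc q. card (SIGMA v:V. ?S v))"
    using assms(1) by (intro sum_mono card_image_le finite_SigmaI finite_tuples)
  also have "\<dots> = Suc q * (\<Sum>v\<in>V. card (?S v))"
    using card_SigmaI[OF assms(1), of ?S] finite_tuples[OF assms(1)] by simp
  finally have "real (card {xs\<in>tuples V (Suc q). \<exists>i<Suc q. length (filter (\<lambda>y. (xs ! i, y) \<in> E) xs) \<le> a * q})
    \<le> real (Suc q) * (\<Sum>v\<in>V. real (card (?S v)))"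
    unfolding of_nat_sum[symmetric] of_nat_mult[symmetric] of_nat_le_iff .
  also have "\<dots> \<le> real (Suc q) * (\<Sum>v\<in>V. (exp (- (\<epsilon>\<^sup>2 / 2)) * card V) ^ q)"
    using assms by (intro mult_left_mono sum_mono chernoff_tuples) auto
  also have "\<dots> = real (Suc q) * exp (- (\<epsilon>\<^sup>2 / 2)) ^ q * real (card V) ^ Suc q"
    by (simp add: power_mult_distrib)
  finally show ?thesis .
qed

text \<open>Erdos' theorem on complete multipartite hypergraphs, by induction on the length. Fix
  \<open>M\<close> first entries that have dense links. By averaging, many tails lie in the links of
  at least \<open>t\<close> of them, and by pigeonhole one \<open>t\<close>-set \<open>S\<close>
  serves a positive proportion of all tails, to which the induction hypothesis applies.\<close>

lemma dense_tuples_contain_box: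
  fixes c :: real
  assumes "0 < c"
  shows "\<exists>n0. \<forall>(V :: 'a set) R. finite V \<longrightarrow> n0 \<le> card V \<longrightarrow> R \<subseteq> tuples V N \<longrightarrow> c * real (card V) ^ N \<le> card R \<longrightarrow>
    (\<exists>A. (\<forall>i<N. A i \<subseteq> V \<and> card (A i) = t) \<and> (\<forall>xs. length xs = N \<longrightarrow> (\<forall>i<N. xs ! i \<in> A i) \<longrightarrow> xs \<in> R))"
  using assms
proof (induction N arbitrary: c)
  case 0
  have "[] \<in> R" if "R \<subseteq> tuples V 0" "c * real (card V) ^ 0 \<le> card R" for V :: "'a set" and R
  proof -
    have "R \<noteq> {}" using that 0 by auto
    then show ?thesis using that by auto
  qed
  then show ?case by (intro exI[of _ 0] allI impI exI[of _ undefined]) auto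
next
  case (Suc N)
  \<comment> \<open>A tail lies on average in at least c M / 2 of the \<open>M\<close> links; this
    choice makes \<open>t\<close> at most half of that, which leaves a proportion c / 4 of good
    tails.\<close>
  obtain M :: nat where "4 * t / c + 1 < M" using reals_Archimedean2 by blast
  moreover have "0 \<le> 4 * t / c" using Suc.prems by simp
  ultimately have "4 * t / c < M" "0 < real M" by linarith+
  then have M: "0 < M" "4 * t \<le> c * M" using Suc.prems by (auto simp: field_simps)
  define c' where "c' = c / 4 / 2 ^ M"
  have "0 < c'" using Suc.prems by (simp add: c'_def)
  from Suc.IH[OF this] obtain n1 where "\<forall>(V :: 'a set) R. finite V \<longrightarrow> n1 \<le> card V \<longrightarrow> R \<subseteq> tuples V N \<longrightarrow>
    c' * real (card V) ^ N \<le> card R \<longrightarrow>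
    (\<exists>A. (\<forall>i<N. A i \<subseteq> V \<and> card (A i) = t) \<and> (\<forall>xs. length xs = N \<longrightarrow> (\<forall>i<N. xs ! i \<in> A i) \<longrightarrow> xs \<in> R))" ..
  note n1 = this[rule_format]
  \<comment> \<open>At least c / 2 * \<open>card V\<close> first entries have a dense link;
    \<open>n2\<close> makes this number exceed \<open>M\<close>.\<close>
  obtain n2 :: nat where n2: "2 * M / c < n2" using reals_Archimedean2 by blast
  show ?case
  proof (rule exI[of _ "max n1 n2"], intro allI impI)
    fix V :: "'a set" and R
    assume V: "finite V" "max n1 n2 \<le> card V" and R: "R \<subseteq> tuples V (Suc N)" "c * real (card V) ^ Suc N \<le> card R"
    let ?n = "real (card V)"
    have n: "2 * M / c < ?n" using n2 V(2) by linarith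
    moreover have "0 \<le> 2 * M / c" using Suc.prems by simp
    ultimately have npos: "0 < ?n" by linarith
    define L where "L x = {ys\<in>tuples V N. x # ys \<in> R}" for x
    have cardL: "real (card (L x)) \<le> ?n ^ N" for x
      unfolding L_def by (rule card_tuples_le[OF V(1)])
    have "R = {zs\<in>tuples V (Suc N). zs \<in> R}" using R by blast
    then have cardR: "real (card R) = (\<Sum>x\<in>V. real (card (L x)))"
      using card_tuples_Suc[OF V(1), of N "\<lambda>zs. zs \<in> R"] by (simp add: L_def)
    define H where "H = {x\<in>V. c / 2 * ?n ^ N \<le> card (L x)}"
    have H: "finite H" "H \<subseteq> V" using V(1) by (auto simp: H_def)
    have "c * ?n ^ Suc N \<le> (\<Sum>x\<in>V - H. real (card (L x))) + (\<Sum>x\<in>H. real (card (L x)))"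
      using R(2) cardR sum.subset_diff[OF H(2) V(1)] by metis
    also have "\<dots> \<le> (\<Sum>x\<in>V - H. c / 2 * ?n ^ N) + (\<Sum>x\<in>H. ?n ^ N)"
      using cardL by (intro add_mono sum_mono) (auto simp: H_def)
    also have "\<dots> = card (V - H) * (c / 2 * ?n ^ N) + card H * ?n ^ N" by simp
    also have "\<dots> \<le> ?n * (c / 2 * ?n ^ N) + card H * ?n ^ N"
      using Suc.prems V(1) H(1) by (intro add_mono mult_right_mono of_nat_mono card_mono) auto
    finally have "(c / 2 * ?n) * ?n ^ N \<le> card H * ?n ^ N" by (simp add: algebra_simps)
    then have "c / 2 * ?n \<le> card H" using npos by simp
    moreover have "M < c / 2 * ?n" using n Suc.prems by (simp add: field_simps)
    ultimately have "M \<le> card H" by linarith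
    then obtain W where W: "W \<subseteq> H" "card W = M" "finite W" by (meson obtain_subset_with_card_n)
    define d where "d ys = card {x\<in>W. x # ys \<in> R}" for ys
    define Y where "Y = {ys\<in>tuples V N. t \<le> d ys}"
    have finY: "finite Y" "Y \<subseteq> tuples V N" unfolding Y_def using finite_tuples[OF V(1)] by auto
    have dM: "d ys \<le> M" for ys
      unfolding d_def W(2)[symmetric] using W(3) by (intro card_mono) auto
    have "M * (c / 2 * ?n ^ N) = (\<Sum>x\<in>W. c / 2 * ?n ^ N)" using W by simp
    also have "\<dots> \<le> (\<Sum>x\<in>W. real (card (L x)))" using W by (intro sum_mono) (auto simp: H_def)
    also have "\<dots> = (\<Sum>ys\<in>tuples V N. real (d ys))"
    proof -
      have "(\<Sum>x\<in>W. card (L x)) = (\<Sum>ys\<in>tuples V N. d ys)"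
        unfolding L_def d_def
        using sum_multicount_gen[of W "tuples V N" "\<lambda>x ys. x # ys \<in> R" "\<lambda>ys. card {x\<in>W. x # ys \<in> R}"]
          W(3) finite_lists_length_eq[OF V(1)] by simp
      then show ?thesis by (simp flip: of_nat_sum)
    qed
    also have "\<dots> \<le> (\<Sum>ys\<in>tuples V N. real t + M * of_bool (t \<le> d ys))"
    proof (rule sum_mono)
      fix ys
      show "real (d ys) \<le> real t + M * of_bool (t \<le> d ys)" using dM[of ys] by (cases "t \<le> d ys") auto
    qed
    also have "\<dots> = t * ?n ^ N + M * card Y"
      using V(1) by (simp add: sum.distrib sum_distrib_left[symmetric] sum_of_bool_eq finite_lists_length_eq
          card_lists_length_eq Y_def Int_def)
    also have "\<dots> \<le> (c * M / 4) * ?n ^ N + M * card Y" using M(2) by (intro add_mono mult_right_mono) auto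
    finally have "M * (c / 4 * ?n ^ N) \<le> M * card Y" by (simp add: algebra_simps)
    then have cardY: "c / 4 * ?n ^ N \<le> card Y" using M(1) by simp
    define F where "F S = {ys\<in>Y. \<forall>x\<in>S. x # ys \<in> R}" for S
    let ?I = "{S. S \<subseteq> W \<and> card S = t}"
    have cover: "Y \<subseteq> (\<Union>S\<in>?I. F S)"
    proof
      fix ys assume ys: "ys \<in> Y"
      then have "t \<le> card {x\<in>W. x # ys \<in> R}" by (simp add: Y_def d_def)
      then obtain S where "S \<subseteq> {x\<in>W. x # ys \<in> R}" "card S = t" by (meson obtain_subset_with_card_n)
      then show "ys \<in> (\<Union>S\<in>?I. F S)" using ys by (auto simp: F_def)
    qed
    have finI: "finite ?I" using W(3) by simp
    have "0 < c / 4 * ?n ^ N" using npos Suc.prems by simp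
    then have "0 < real (card Y)" using cardY by linarith
    then have "Y \<noteq> {}" by auto
    then have Ine: "?I \<noteq> {}" using cover by blast
    have "\<exists>S\<in>?I. (c / 4 * ?n ^ N) / card ?I \<le> card (F S)"
      using finI Ine cover cardY finY by (intro exists_large_member[where A = Y]) (auto simp: F_def)
    then obtain S where S: "S \<subseteq> W" "card S = t" "(c / 4 * ?n ^ N) / card ?I \<le> card (F S)" by blast
    have "card ?I \<le> card (Pow W)" using W(3) by (intro card_mono) auto
    then have "card ?I \<le> 2 ^ M" using W by (simp add: card_Pow)
    then have "real (card ?I) \<le> real (2 ^ M)" by (rule of_nat_mono)
    then have "real (card ?I) \<le> 2 ^ M" by simp
    moreover have "0 < real (card ?I)" using finI Ine by (simp add: card_gt_0_iff)
    ultimately have "(c / 4 * ?n ^ N) / 2 ^ M \<le> (c / 4 * ?n ^ N) / card ?I"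
      using Suc.prems by (intro divide_left_mono) auto
    then have "c' * ?n ^ N \<le> card (F S)" using S(3) by (simp add: c'_def)
    moreover have "F S \<subseteq> tuples V N" using finY by (auto simp: F_def)
    moreover have "n1 \<le> card V" using V(2) by simp
    ultimately have "\<exists>A. (\<forall>i<N. A i \<subseteq> V \<and> card (A i) = t) \<and>
      (\<forall>xs. length xs = N \<longrightarrow> (\<forall>i<N. xs ! i \<in> A i) \<longrightarrow> xs \<in> F S)"
      using V(1) by (intro n1)
    then obtain A where A: "\<forall>i<N. A i \<subseteq> V \<and> card (A i) = t"
      "\<forall>xs. length xs = N \<longrightarrow> (\<forall>i<N. xs ! i \<in> A i) \<longrightarrow> xs \<in> F S"
      by (elim exE conjE)
    have "\<forall>i<Suc N. case_nat S A i \<subseteq> V \<and> card (case_nat S A i) = t"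
      using A(1) S W H by (auto split: nat.split)
    moreover have "xs \<in> R" if len: "length xs = Suc N" and box: "\<forall>i<Suc N. xs ! i \<in> case_nat S A i" for xs
    proof -
      obtain x ys where xs: "xs = x # ys" "length ys = N" using len by (auto simp: length_Suc_conv)
      have "x \<in> S" using box[rule_format, of 0] xs by simp
      moreover have "ys ! i \<in> A i" if "i < N" for i
        using box[rule_format, of "Suc i"] that xs by simp
      then have "ys \<in> F S" using A(2) xs by blast
      ultimately show ?thesis using xs by (simp add: F_def)
    qed
    ultimately show "\<exists>A. (\<forall>i<Suc N. A i \<subseteq> V \<and> card (A i) = t) \<and>
      (\<forall>xs. length xs = Suc N \<longrightarrow> (\<forall>i<Suc N. xs ! i \<in> A i) \<longrightarrow> xs \<in> R)"
      by (intro exI[of _ "case_nat S A"]) blast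
  qed
qed

section \<open>The stability theorem\<close>

text \<open>By pigeonhole one index list \<open>is\<close> works for a positive proportion of the
  tuples. These contain a box, and the sides of the box at the positions in \<open>is\<close> are
  the parts of the blow-up.\<close>

lemma dense_transitive_tuples_contain_blow_up:
  fixes c :: real
  assumes "0 < c" "1 \<le> t"
  shows "\<exists>n0. \<forall>(V :: 'a set) E. finite V \<longrightarrow> n0 \<le> card V \<longrightarrow> irrefl E \<longrightarrow>
    c * real (card V) ^ N \<le> card {xs\<in>tuples V N. \<exists>is\<in>tuples {..<N} r. sorted_wrt (\<lambda>u v. (u, v) \<in> E) (map ((!) xs) is)} \<longrightarrow>
    (\<exists>B. (\<forall>i<r. B i \<subseteq> V \<and> card (B i) = t) \<and> (\<forall>j<r. \<forall>i<j. B i \<times> B j \<subseteq> E))"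
proof -
  let ?I = "tuples {..<N} r"
  have finI: "finite ?I" by (rule finite_lists_length_eq) simp
  \<comment> \<open>The added 1 keeps \<open>c'\<close> positive before the index set is known to be
    non-empty.\<close>
  define c' where "c' = c / (card ?I + 1)"
  have "0 < c'" using assms by (simp add: c'_def)
  from dense_tuples_contain_box[OF this, where 'a = 'a and N = N and t = t]
  obtain n1 where "\<forall>(V :: 'a set) R. finite V \<longrightarrow> n1 \<le> card V \<longrightarrow> R \<subseteq> tuples V N \<longrightarrow> c' * real (card V) ^ N \<le> card R \<longrightarrow>
    (\<exists>A. (\<forall>i<N. A i \<subseteq> V \<and> card (A i) = t) \<and> (\<forall>xs. length xs = N \<longrightarrow> (\<forall>i<N. xs ! i \<in> A i) \<longrightarrow> xs \<in> R))" ..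
  note n1 = this[rule_format]
  show ?thesis
  proof (rule exI[of _ "max 1 n1"], intro allI impI)
    fix V :: "'a set" and E
    let ?n = "real (card V)"
    define R where "R is = {xs\<in>tuples V N. sorted_wrt (\<lambda>u v. (u, v) \<in> E) (map ((!) xs) is)}" for "is"
    let ?T = "{xs\<in>tuples V N. \<exists>is\<in>?I. sorted_wrt (\<lambda>u v. (u, v) \<in> E) (map ((!) xs) is)}"
    assume V: "finite V" "max 1 n1 \<le> card V" and irr: "irrefl E" and dense: "c * ?n ^ N \<le> card ?T"
    have "0 < ?n" using V(2) by simp
    then have pos: "0 < c * ?n ^ N" using assms(1) by simp
    then have "?T \<noteq> {}" using dense by (metis (no_types, lifting) card.empty not_less of_nat_0)
    then have Ine: "?I \<noteq> {}" by blast
    have "?T \<subseteq> (\<Union>is\<in>?I. R is)" by (auto simp: R_def)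
    then have "\<exists>is\<in>?I. c * ?n ^ N / card ?I \<le> card (R is)"
      using dense unfolding R_def
      by (intro exists_large_member[OF finI Ine] finite_tuples[OF V(1)])
    then obtain "is" where "is": "set is \<subseteq> {..<N}" "length is = r" "c * ?n ^ N / card ?I \<le> card (R is)" by blast
    have "c * ?n ^ N / (card ?I + 1) \<le> c * ?n ^ N / card ?I"
      using pos finI Ine by (intro divide_left_mono) (auto simp: card_gt_0_iff)
    then have "c' * ?n ^ N \<le> card (R is)" using "is"(3) by (simp add: c'_def)
    moreover have "R is \<subseteq> tuples V N" by (auto simp: R_def)
    moreover have "n1 \<le> card V" using V(2) by simp
    ultimately have "\<exists>A. (\<forall>i<N. A i \<subseteq> V \<and> card (A i) = t) \<and>
      (\<forall>xs. length xs = N \<longrightarrow> (\<forall>i<N. xs ! i \<in> A i) \<longrightarrow> xs \<in> R is)"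
      using V(1) by (intro n1)
    then obtain A where A: "\<forall>i<N. A i \<subseteq> V \<and> card (A i) = t"
      "\<forall>xs. length xs = N \<longrightarrow> (\<forall>i<N. xs ! i \<in> A i) \<longrightarrow> xs \<in> R is"
      by (elim exE conjE)
    have isN: "is ! i < N" if "i < r" for i using that "is"(1,2) nth_mem by fastforce
    have "\<exists>a. a \<in> A i" if "i < N" for i
    proof -
      have "card (A i) \<noteq> 0" using A(1) that assms(2) by auto
      then show ?thesis by (metis card.empty ex_in_conv)
    qed
    then obtain g where g: "\<And>i. i < N \<Longrightarrow> g i \<in> A i" by metis
    have edge: "(h (is ! i), h (is ! j)) \<in> E" if "i < j" "j < r" "\<And>i. i < N \<Longrightarrow> h i \<in> A i" for i j h
    proof -
      have "map h [0..<N] \<in> R is" using A(2) that(3) by simp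
      then have "sorted_wrt (\<lambda>u v. (u, v) \<in> E) (map ((!) (map h [0..<N])) is)" by (simp add: R_def)
      then show ?thesis using that(1,2) "is"(2) isN by (simp add: sorted_wrt_iff_nth_less)
    qed
    have "(x, y) \<in> E" if "i < j" "j < r" "x \<in> A (is ! i)" "y \<in> A (is ! j)" for i j x y
    proof -
      \<comment> \<open>Equal positions would give a loop at a value of \<open>g\<close>. As they
        differ, \<open>x\<close> and \<open>y\<close> can be prescribed there
        simultaneously.\<close>
      have "is ! i \<noteq> is ! j" using edge[OF that(1,2) g] irr by (metis irrefl_def)
      then show ?thesis
        using edge[OF that(1,2), of "g(is ! i := x, is ! j := y)"] g that by simp
    qed
    then show "\<exists>B. (\<forall>i<r. B i \<subseteq> V \<and> card (B i) = t) \<and> (\<forall>j<r. \<forall>i<j. B i \<times> B j \<subseteq> E)"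
      using A(1) isN by (intro exI[of _ "\<lambda>i. A (is ! i)"]) auto
  qed
qed

text \<open>The sets \<open>B i\<close> are disjoint, since a common vertex would carry a loop.
  Hence the vertex map is injective, and the image of the blow-up under it is the required
  subdigraph.\<close>

lemma not_blow_up_free:
  assumes "pair_digraph D"
    and B: "\<And>i. i < r \<Longrightarrow> B i \<subseteq> pverts D \<and> card (B i) = t"
    and arcs: "\<And>i j. i < j \<Longrightarrow> j < r \<Longrightarrow> B i \<times> B j \<subseteq> parcs D"
  shows "\<not> digraph_free (with_proj (blow_up (transitive_tournament r) t)) (with_proj D)"
proof -
  interpret D: pair_digraph D by fact
  let ?H = "blow_up (transitive_tournament r) t"
  have "\<exists>b. bij_betw b {1..t} (B i)" if "i < r" for i
    using ex_bij_betw_nat_finite_1[of "B i"] B[OF that] D.pair_finite_verts finite_subset by metis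
  then obtain b where b: "\<And>i. i < r \<Longrightarrow> bij_betw (b i) {1..t} (B i)" by metis
  \<comment> \<open>The tournament is numbered from 1 and the family \<open>B\<close> from
    0.\<close>
  define \<phi> where "\<phi> = (\<lambda>(i, s). b (i - 1) s)"
  have \<phi>: "\<phi> (i, s) \<in> B (i - 1)" if "1 \<le> i" "i \<le> r" "s \<in> {1..t}" for i s
    using bij_betwE[OF b[of "i - 1"]] that by (auto simp: \<phi>_def)
  have \<phi>_arc: "(\<phi> (i, s), \<phi> (j, s')) \<in> parcs D"
    if "1 \<le> i" "i < j" "j \<le> r" "s \<in> {1..t}" "s' \<in> {1..t}" for i j s s'
  proof -
    have "B (i - 1) \<times> B (j - 1) \<subseteq> parcs D" using that by (intro arcs) auto
    then show ?thesis using \<phi>[of i s] \<phi>[of j s'] that by auto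
  qed
  have inj: "inj_on \<phi> (pverts ?H)"
  proof (rule inj_onI, clarify)
    fix i s j s' assume *: "(i, s) \<in> pverts ?H" "(j, s') \<in> pverts ?H" "\<phi> (i, s) = \<phi> (j, s')"
    then have ij: "1 \<le> i" "i \<le> r" "1 \<le> j" "j \<le> r" "s \<in> {1..t}" "s' \<in> {1..t}"
      by (auto simp: blow_up_def transitive_tournament_def)
    have "i = j"
    proof (rule ccontr)
      assume "i \<noteq> j"
      then have "(\<phi> (i, s), \<phi> (j, s')) \<in> parcs D \<or> (\<phi> (j, s'), \<phi> (i, s)) \<in> parcs D"
        using \<phi>_arc ij by (metis linorder_neqE_nat)
      then show False using D.pair_no_loops *(3) by fastforce
    qed
    moreover have "inj_on (b (i - 1)) {1..t}" using b[of "i - 1"] ij by (auto simp: bij_betw_def)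
    ultimately show "i = j \<and> s = s'" using *(3) ij by (auto simp: \<phi>_def dest: inj_onD)
  qed
  define hom where "hom = \<lparr> iso_verts = \<phi>, iso_arcs = map_prod \<phi> \<phi>, iso_head = snd, iso_tail = fst \<rparr>"
  have wfH: "wf_digraph (with_proj ?H)"
    by unfold_locales (auto simp: blow_up_def transitive_tournament_def)
  have arcsH: "parcs ?H \<subseteq> pverts ?H \<times> pverts ?H"
    by (auto simp: blow_up_def transitive_tournament_def)
  have "inj_on (map_prod \<phi> \<phi>) (parcs ?H)"
    by (rule inj_on_subset[OF map_prod_inj_on[OF inj inj] arcsH])
  then have hom: "pre_digraph.digraph_isomorphism (with_proj ?H) hom"
    using wfH inj by (auto simp: pre_digraph.digraph_isomorphism_def hom_def)
  have "\<phi> ` pverts ?H \<subseteq> pverts D"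
  proof clarify
    fix i s assume "(i, s) \<in> pverts ?H"
    then have "1 \<le> i" "i \<le> r" "s \<in> {1..t}" by (auto simp: blow_up_def transitive_tournament_def)
    moreover from this have "B (i - 1) \<subseteq> pverts D" using B[of "i - 1"] by simp
    ultimately show "\<phi> (i, s) \<in> pverts D" using \<phi> by blast
  qed
  moreover have "map_prod \<phi> \<phi> ` parcs ?H \<subseteq> parcs D"
    using \<phi>_arc by (auto simp: blow_up_def transitive_tournament_def)
  ultimately have "subgraph (app_iso hom (with_proj ?H)) (with_proj D)"
    using wf_digraph.wf_digraphI_app_iso[OF wfH hom] D.wf_digraph_axioms
    by (simp add: subgraph_def compatible_def app_iso_def hom_def)
  moreover have "digraph_iso (with_proj ?H) (app_iso hom (with_proj ?H))"
    using hom by (auto simp: digraph_iso_def)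
  ultimately show ?thesis by (auto simp: digraph_free_def)
qed

text \<open>The colouring theorem is applied to the positions of the tuple, not to the set of its
  entries, so that repetitions count towards degrees. The colouring is pulled back by choosing one
  position for each entry.\<close>

lemma good_tuple_colourable:
  fixes e :: real
  assumes "irrefl E" "length xs = Suc q"
    and free: "\<And>is. is \<in> tuples {..<Suc q} (m + 2) \<Longrightarrow> \<not> sorted_wrt (\<lambda>u v. (u, v) \<in> E) (map ((!) xs) is)"
    and deg: "\<And>i. i < Suc q \<Longrightarrow> ((3 * real m - 1) / (3 * real m + 2) + e) * q < length (filter (\<lambda>y. (xs ! i, y) \<in> E) xs)"
    and "1 \<le> e * q"
  shows "list_colourable E (\<lambda>_. {..<m + 1}) xs"
proof -
  let ?N = "Suc q"
  define E' where "E' = {(i, j). i < ?N \<and> j < ?N \<and> (xs ! i, xs ! j) \<in> E}"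
  have "\<exists>f. proper_colouring (m + 1) E' {..<?N} f"
  proof (rule transitive_free_colourable)
    show "irrefl E'" using assms(1) by (auto simp: E'_def irrefl_def)
    show "\<not> sorted_wrt (\<lambda>u v. (u, v) \<in> E') is" if "length is = m + 2" "set is \<subseteq> {..<?N}" for "is"
    proof
      assume "sorted_wrt (\<lambda>u v. (u, v) \<in> E') is"
      then have "sorted_wrt (\<lambda>u v. (u, v) \<in> E) (map ((!) xs) is)"
        unfolding sorted_wrt_map by (rule sorted_wrt_mono_rel[rotated]) (auto simp: E'_def)
      then show False using free that by blast
    qed
    show "(3 * real m + 2) * card {j\<in>{..<?N}. (i, j) \<notin> E'} < 3 * card {..<?N}" if "i \<in> {..<?N}" for i
    proof -
      let ?L = "length (filter (\<lambda>y. (xs ! i, y) \<in> E) xs)"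
      have "?L = card {j\<in>{..<?N}. (i, j) \<in> E'}"
        unfolding length_filter_conv_card using that assms(2) by (intro arg_cong[where f = card]) (auto simp: E'_def)
      moreover have "card {j\<in>{..<?N}. (i, j) \<in> E'} + card {j\<in>{..<?N}. (i, j) \<notin> E'} = card {..<?N}"
      proof -
        have "{j\<in>{..<?N}. (i, j) \<in> E'} \<union> {j\<in>{..<?N}. (i, j) \<notin> E'} = {..<?N}" by blast
        then show ?thesis by (subst card_Un_disjoint[symmetric]) auto
      qed
      ultimately have missing: "real (card {j\<in>{..<?N}. (i, j) \<notin> E'}) = real ?N - ?L" by simp
      \<comment> \<open>Degrees are measured against \<open>q\<close>, while the sample has
        \<open>q + 1\<close> positions; the slack \<open>e * q \<ge> 1\<close> absorbs the
        difference.\<close>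
      have "(3 * real m + 2) * (((3 * real m - 1) / (3 * real m + 2) + e) * q) < (3 * real m + 2) * ?L"
        using deg[of i] that by (intro mult_strict_left_mono) auto
      moreover have "(3 * real m + 2) * (((3 * real m - 1) / (3 * real m + 2) + e) * q)
        = (3 * real m - 1) * q + (3 * real m + 2) * (e * q)"
        by (simp add: field_simps)
      moreover have "(3 * real m + 2) * 1 \<le> (3 * real m + 2) * (e * q)"
        using assms(5) by (intro mult_left_mono) auto
      ultimately show ?thesis unfolding missing by (simp add: algebra_simps)
    qed
  qed (auto simp: E'_def)
  then obtain f where f: "f ` {..<?N} \<subseteq> {..<m + 1}"
    "\<And>i j. i < ?N \<Longrightarrow> j < ?N \<Longrightarrow> (i, j) \<in> E' \<Longrightarrow> f i \<noteq> f j"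
    unfolding proper_colouring_def by blast
  have "\<forall>v\<in>set xs. \<exists>i. i < ?N \<and> xs ! i = v" using assms(2) by (simp add: in_set_conv_nth)
  from bchoice[OF this] obtain g where g: "\<And>v. v \<in> set xs \<Longrightarrow> g v < ?N \<and> xs ! g v = v" by blast
  have "\<forall>v\<in>set xs. f (g v) \<in> {..<m + 1}" using f(1) g by blast
  moreover have "\<forall>u\<in>set xs. \<forall>v\<in>set xs. (u, v) \<in> E \<longrightarrow> f (g u) \<noteq> f (g v)"
  proof (intro ballI impI)
    fix u v assume uv: "u \<in> set xs" "v \<in> set xs" "(u, v) \<in> E"
    note gu = g[OF uv(1)] and gv = g[OF uv(2)]
    have "(xs ! g u, xs ! g v) \<in> E" unfolding gu[THEN conjunct2] gv[THEN conjunct2] by (rule uv(3))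
    then have "(g u, g v) \<in> E'" unfolding E'_def using gu gv by blast
    then show "f (g u) \<noteq> f (g v)" by (rule f(2)[OF gu[THEN conjunct1] gv[THEN conjunct1]])
  qed
  ultimately show ?thesis unfolding list_colourable_def by (intro exI[of _ "\<lambda>v. f (g v)"] conjI)
qed

theorem theorem1p2:
  fixes r t :: nat and \<epsilon> :: real
  assumes "r \<ge> 3" and "t \<ge> 1" and "\<epsilon> > 0"
  shows "\<forall>\<eta>::real. \<eta> > 0 \<longrightarrow>
    (\<exists>n0::nat. \<forall>n \<ge> n0. \<forall>D :: 'a pair_pre_digraph.
      pair_digraph D \<longrightarrow>
      card (pverts D) = n \<longrightarrow>
      digraph_free (with_proj (blow_up (transitive_tournament r) t)) (with_proj D) \<longrightarrow>
      real (min_out_degree (with_proj D)) \<ge> ((3 * real r - 7) / (3 * real r - 4) + \<epsilon>) * real n \<longrightarrow>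
      (\<exists>A \<subseteq> parcs D. real (card A) \<le> \<eta> * (real n)\<^sup>2 \<and>
        partite (r - 1) (with_proj (delete_arcs D A))))"
proof (intro allI impI)
  fix \<eta> :: real
  assume \<eta>: "\<eta> > 0"
  define m where "m = r - 2"
  have r: "r = m + 2" "1 \<le> m" "r - 1 = m + 1" using assms(1) by (simp_all add: m_def)
  define x where "x = (3 * real m - 1) / (3 * real m + 2)"
  have x: "(3 * real r - 7) / (3 * real r - 4) = x" by (simp add: x_def r)
  \<comment> \<open>Half of \<epsilon> is spent on the Chernoff bound, the other half is the slack
    in the sample.\<close>
  define e where "e = \<epsilon> / 2"
  have e: "0 < e" using assms(3) by (simp add: e_def)
  have x0: "0 \<le> x" using r(2) by (simp add: x_def)
  define \<theta> where "\<theta> = exp (- (e\<^sup>2 / 2))"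
  have \<theta>: "0 < \<theta>" "\<theta> < 1" using e by (auto simp: \<theta>_def)
  \<comment> \<open>Three kinds of tuples are to cover at most a quarter of all tuples each: the
    colourable ones, those with a low out-degree, and those containing a transitive
    tournament.\<close>
  have "0 < m + 1" "0 < (1 / 4 :: real)" by simp_all
  from few_colourable[OF this(1) \<eta> this(2), where 'a = 'a] obtain q0 where
    "\<forall>q\<ge>q0. \<forall>(V :: 'a set) E. finite V \<longrightarrow> E \<subseteq> V \<times> V \<longrightarrow> far_from_colourable (m + 1) \<eta> V E \<longrightarrow>
    card {xs\<in>tuples V q. list_colourable E (\<lambda>_. {..<m + 1}) xs} \<le> 1 / 4 * real (card V) ^ q" ..
  note q0 = this[rule_format]
  have "(\<lambda>q. real q * \<theta> ^ q + \<theta> ^ q) \<longlonglongrightarrow> 0 + 0"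
    using \<theta> by (intro tendsto_add powser_times_n_limit_0 LIMSEQ_power_zero) auto
  then have "\<forall>\<^sub>F q in sequentially. real q * \<theta> ^ q + \<theta> ^ q < 1 / 4"
    by (rule order_tendstoD) simp
  moreover have "\<forall>\<^sub>F q in sequentially. 1 / e \<le> real q"
    using filterlim_real_sequentially by (simp add: filterlim_at_top)
  moreover have "\<forall>\<^sub>F q in sequentially. q0 \<le> q" by (rule eventually_ge_at_top)
  ultimately have "\<forall>\<^sub>F q in sequentially. real q * \<theta> ^ q + \<theta> ^ q < 1 / 4 \<and> 1 / e \<le> real q \<and> q0 \<le> q"
    by eventually_elim simp
  then obtain q where "real q * \<theta> ^ q + \<theta> ^ q < 1 / 4 \<and> 1 / e \<le> real q \<and> q0 \<le> q"
    using eventually_happens'[OF sequentially_bot] by blast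
  then have q: "real (Suc q) * \<theta> ^ q \<le> 1 / 4" "1 \<le> e * q" "q0 \<le> Suc q"
    using e by (auto simp: field_simps)
  have "0 < (1 / 4 :: real)" by simp
  from dense_transitive_tuples_contain_blow_up[OF this assms(2), where 'a = 'a and N = "Suc q" and r = r]
  obtain n1 where
    "\<forall>(V :: 'a set) E. finite V \<longrightarrow> n1 \<le> card V \<longrightarrow> irrefl E \<longrightarrow>
    1 / 4 * real (card V) ^ Suc q \<le> card {xs\<in>tuples V (Suc q). \<exists>is\<in>tuples {..<Suc q} r. sorted_wrt (\<lambda>u v. (u, v) \<in> E) (map ((!) xs) is)} \<longrightarrow>
    (\<exists>B. (\<forall>i<r. B i \<subseteq> V \<and> card (B i) = t) \<and> (\<forall>j<r. \<forall>i<j. B i \<times> B j \<subseteq> E))" ..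
  note n1 = this[rule_format]
  show "\<exists>n0::nat. \<forall>n \<ge> n0. \<forall>D :: 'a pair_pre_digraph.
      pair_digraph D \<longrightarrow>
      card (pverts D) = n \<longrightarrow>
      digraph_free (with_proj (blow_up (transitive_tournament r) t)) (with_proj D) \<longrightarrow>
      real (min_out_degree (with_proj D)) \<ge> ((3 * real r - 7) / (3 * real r - 4) + \<epsilon>) * real n \<longrightarrow>
      (\<exists>A \<subseteq> parcs D. real (card A) \<le> \<eta> * (real n)\<^sup>2 \<and>
        partite (r - 1) (with_proj (delete_arcs D A)))"
  proof (rule exI[of _ "max 1 n1"], intro allI impI)
    fix n and D :: "'a pair_pre_digraph"
    assume n: "max 1 n1 \<le> n" and D: "pair_digraph D" and card: "card (pverts D) = n"
      and free: "digraph_free (with_proj (blow_up (transitive_tournament r) t)) (with_proj D)"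
      and deg: "real (min_out_degree (with_proj D)) \<ge> ((3 * real r - 7) / (3 * real r - 4) + \<epsilon>) * real n"
    interpret D: pair_digraph D by fact
    let ?V = "pverts D" and ?E = "parcs D"
    \<comment> \<open>The bound n \<ge> 1 excludes the digraph without vertices, whose minimum
      out-degree is unspecified.\<close>
    have V: "finite ?V" "?V \<noteq> {}" "n1 \<le> card ?V" "0 < real (card ?V)"
      using D.pair_finite_verts n card by auto
    have E: "?E \<subseteq> ?V \<times> ?V" using D.wellformed' by auto
    have irr: "irrefl ?E" using D.pair_no_loops by (fastforce simp: irrefl_def)
    have degV: "((x + e) + e) * card ?V \<le> card {w\<in>?V. (v, w) \<in> ?E}" if "v \<in> ?V" for v
    proof -
      have "min_out_degree (with_proj D) \<le> out_degree (with_proj D) v"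
        using V(1) that by (simp add: min_out_degree_def)
      also have "out_degree (with_proj D) v = card ((\<lambda>w. (v, w)) ` {w\<in>?V. (v, w) \<in> ?E})"
        using E by (auto simp: out_degree_def out_arcs_def intro!: arg_cong[where f = card])
      also have "\<dots> = card {w\<in>?V. (v, w) \<in> ?E}" by (rule card_image) (simp add: inj_on_def)
      finally have "min_out_degree (with_proj D) \<le> card {w\<in>?V. (v, w) \<in> ?E}" .
      moreover have "(x + \<epsilon>) * card ?V \<le> min_out_degree (with_proj D)" using deg card x by simp
      ultimately have "(x + \<epsilon>) * card ?V \<le> card {w\<in>?V. (v, w) \<in> ?E}" by linarith
      moreover have "x + \<epsilon> = (x + e) + e" by (simp add: e_def)
      ultimately show ?thesis by (simp only:)
    qed
    have "\<not> far_from_colourable (m + 1) \<eta> ?V ?E"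
    proof
      assume far: "far_from_colourable (m + 1) \<eta> ?V ?E"
      let ?T = "tuples ?V (Suc q)" and ?N = "real (card ?V) ^ Suc q"
      define C where "C = {xs\<in>?T. list_colourable ?E (\<lambda>_. {..<m + 1}) xs}"
      define L where "L = {xs\<in>?T. \<exists>i<Suc q. length (filter (\<lambda>y. (xs ! i, y) \<in> ?E) xs) \<le> (x + e) * q}"
      define S where "S = {xs\<in>?T. \<exists>is\<in>tuples {..<Suc q} r. sorted_wrt (\<lambda>u v. (u, v) \<in> ?E) (map ((!) xs) is)}"
      \<comment> \<open>A tuple outside \<open>L\<close> and \<open>S\<close> is colourable, so the
        three sets exhaust all tuples, although together they cover less than three quarters of
        them.\<close>
      have "?T \<subseteq> C \<union> L \<union> S"
      proof
        fix xs assume xs: "xs \<in> ?T"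
        have "xs \<in> C" if "xs \<notin> L" "xs \<notin> S"
        proof -
          have "list_colourable ?E (\<lambda>_. {..<m + 1}) xs"
          proof (rule good_tuple_colourable[OF irr _ _ _ q(2)])
            show "length xs = Suc q" using xs by simp
            show "\<not> sorted_wrt (\<lambda>u v. (u, v) \<in> ?E) (map ((!) xs) is)" if "is \<in> tuples {..<Suc q} (m + 2)" for "is"
              using \<open>xs \<notin> S\<close> xs that unfolding S_def r(1) by blast
            show "((3 * real m - 1) / (3 * real m + 2) + e) * q < length (filter (\<lambda>y. (xs ! i, y) \<in> ?E) xs)"
              if "i < Suc q" for i
            proof -
              have "\<not> (\<exists>i<Suc q. length (filter (\<lambda>y. (xs ! i, y) \<in> ?E) xs) \<le> (x + e) * q)"
                using \<open>xs \<notin> L\<close> xs unfolding L_def by blast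
              then show ?thesis using that by (simp add: x_def not_le)
            qed
          qed
          then show ?thesis using xs by (simp add: C_def)
        qed
        then show "xs \<in> C \<union> L \<union> S" by blast
      qed
      moreover have fin: "finite C" "finite L" "finite S"
        unfolding C_def L_def S_def by (rule finite_tuples[OF V(1)])+
      ultimately have "card ?T \<le> card (C \<union> L \<union> S)" by (intro card_mono) auto
      also have "\<dots> \<le> card C + card L + card S" by (meson add_le_mono1 card_Un_le order_trans)
      finally have "real (card ?T) \<le> real (card C) + card L + card S" by linarith
      moreover have "real (card ?T) = ?N" by (simp add: card_lists_length_eq[OF V(1)])
      moreover have "real (card C) \<le> 1 / 4 * ?N" unfolding C_def by (rule q0[OF q(3) V(1) E far])
      moreover have "real (card L) \<le> 1 / 4 * ?N"
      proof -
        have "real (card L) \<le> real (Suc q) * \<theta> ^ q * ?N"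
          unfolding L_def \<theta>_def using V(1) e x0 degV by (intro few_low_degree_tuples) auto
        also have "\<dots> \<le> 1 / 4 * ?N" using q(1) by (intro mult_right_mono) auto
        finally show ?thesis .
      qed
      moreover have "real (card S) < 1 / 4 * ?N"
      proof (rule ccontr)
        assume "\<not> ?thesis"
        then have "1 / 4 * ?N \<le> card S" by simp
        from n1[OF V(1,3) irr this[unfolded S_def]]
        obtain B where "\<forall>i<r. B i \<subseteq> ?V \<and> card (B i) = t" "\<forall>j<r. \<forall>i<j. B i \<times> B j \<subseteq> ?E" by blast
        then show False using not_blow_up_free[OF D, of r B t] free by blast
      qed
      moreover have "0 < ?N" using V(4) by simp
      ultimately show False by linarith
    qed
    then obtain f where f: "f ` ?V \<subseteq> {..<m + 1}" "card {(u, v)\<in>?E. f u = f v} \<le> \<eta> * (real n)\<^sup>2"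
      unfolding far_from_colourable_def card by (auto simp: not_less)
    let ?A = "{(u, v)\<in>?E. f u = f v}"
    have "partite (r - 1) (with_proj (delete_arcs D ?A))"
      unfolding partite_def r(3)
    proof (intro exI[of _ "\<lambda>i. {v\<in>?V. f v = i}"] conjI)
      show "(\<Union>i<m + 1. {v\<in>?V. f v = i}) = verts (with_proj (delete_arcs D ?A))"
        using f(1) by (auto simp: delete_arcs_def)
      show "disjoint_family_on (\<lambda>i. {v\<in>?V. f v = i}) {..<m + 1}" by (auto simp: disjoint_family_on_def)
    qed (auto simp: delete_arcs_def)
    then show "\<exists>A \<subseteq> parcs D. real (card A) \<le> \<eta> * (real n)\<^sup>2 \<and> partite (r - 1) (with_proj (delete_arcs D A))"
      using f(2) by (intro exI[of _ ?A]) blast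
  qed
qed

end
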